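(* Let $k$ be a field of characteristic zero. (i) Let $s=(0,s_1,\dots,s_e)$ be a socle-vector. Then the minimum $h$-vector for $s$ exists and is $h=(1,h_1,\dots,h_e)$, where $h_e=s_e$ and, inductively (descending), for $i=e-1,\dots,1$, $$h_i=((h_{i+1})_{(i+1)})_{-1}^{-1}+s_i .$$ In particular, the minimum codimension for $s$ is $$r=h_1=((\dots((((s_e)_{(e)})_{-1}^{-1}+s_{e-1})_{(e-1)})_{-1}^{-1}+s_{e-2}\dots)_{(2)})_{-1}^{-1}+s_1 .$$ (ii) Let $h=(1,h_1,\dots,h_e)$ be an $h$-vector. Then the maximum socle-vector for $h$ exists and is $s=(0,s_1,\dots,s_e)$, where $s_e=h_e$ and, for $i=1,\dots,e-1$, $$s_i=h_i-((h_{i+1})_{(i+1)})_{-1}^{-1}.$$ (iii) For an $h$-vector $h$ and a socle-vector $s$: $h$ is the minimum $h$-vector for $s$ if and only if $s$ is the maximum socle-vector for $h$.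
   Context: Algebras are standard graded artinian $k$-algebras $A=R/I$, with $R=k[x_1,\dots,x_r]$, $k$ a fixed field of characteristic zero, and $I$ a homogeneous ideal containing no non-zero forms of degree 1; $r$ is arbitrary. The $h$-vector of $A$ is $h(A)=(h_0,h_1,\dots,h_e)$, where $h_i=\dim_k A_i$ and $e$ is the last index with $A_e\neq 0$; thus $h_0=1$ and $h_1=r$ is the codimension of $A$ (or of $h$). It is assumed that $e\ge 1$. The socle of $A$ is $soc(A)=\{a\in A : a\overline{m}=0\}$, where $\overline m=(\overline{x_1},\dots,\overline{x_r})$, and the socle-vector of $A$ is $s(A)=(s_0,s_1,\dots,s_e)$ with $s_i=\dim_k soc(A)_i$; thus $s_0=0$ and $s_e=h_e>0$. "An $h$-vector" (resp. "a socle-vector") means a tuple that is the $h$-vector (resp. socle-vector) of some such algebra. Tuples of integers of the same length are partially ordered entry by entry. Given a socle-vector $s$, the minimum $h$-vector for $s$ (if it exists) is the $h$-vector that is the entry by entry minimum among the $h$-vectors of all such algebras (of any codimension) having socle-vector $s$; the minimum codimension for $s$ is its entry of degree 1, i.e. the least codimension of an algebra with socle-vector $s$. Given an $h$-vector $h$, the maximum socle-vector for $h$ (if it exists) is the socle-vector that is the entry by entry maximum among the socle-vectors of all such algebras having $h$-vector $h$. For positive integers $n,i$, the $i$-binomial expansion of $n$ is the unique expression $n_{(i)}=\binom{n_i}{i}+\binom{n_{i-1}}{i-1}+\dots+\binom{n_j}{j}$ with $n_i>n_{i-1}>\dots>n_j\ge j\ge 1$. For an integer $a$, $(n_{(i)})_a^a=\binom{n_i+a}{i+a}+\binom{n_{i-1}+a}{i-1+a}+\dots+\binom{n_j+a}{j+a}$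 (with $\binom{m}{0}=1$ for $m\ge 0$). *)

theory Defs
  imports
    "HOL-Library.Poly_Mapping"
    "HOL-Algebra.QuotRing"
    "HOL-Algebra.Embedded_Algebras"
begin

section \<open>Polynomial rings\<close>

text \<open>
  Monomials are exponent vectors \<open>nat \<Rightarrow>\<^sub>0 nat\<close>, and \<open>poly_ring r\<close> is the polynomial
  ring over the field \<open>'k\<close> in the variables with indices \<open>0, \<dots>, r - 1\<close>.
\<close>

type_synonym 'k mpoly = "(nat \<Rightarrow>\<^sub>0 nat) \<Rightarrow>\<^sub>0 'k"

definition mono_deg :: "(nat \<Rightarrow>\<^sub>0 nat) \<Rightarrow> nat" where
  "mono_deg m = (\<Sum>i\<in>Poly_Mapping.keys m. Poly_Mapping.lookup m i)"

definition const_poly :: "'k::field_char_0 \<Rightarrow> 'k mpoly" where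
  "const_poly c = Poly_Mapping.single 0 c"

definition var_poly :: "nat \<Rightarrow> 'k::field_char_0 mpoly" where
  "var_poly i = Poly_Mapping.single (Poly_Mapping.single i 1) 1"

definition poly_ring :: "nat \<Rightarrow> 'k::field_char_0 mpoly ring" where
  "poly_ring r =
    \<lparr>carrier = {p. \<forall>m\<in>Poly_Mapping.keys p. Poly_Mapping.keys m \<subseteq> {..<r}},
     mult = (*), one = 1, zero = 0, add = (+)\<rparr>"

lemma cring_poly_ring: "cring (poly_ring r :: 'k::field_char_0 mpoly ring)"
proof (rule cringI)
  let ?C = "{p :: 'k mpoly. \<forall>m\<in>Poly_Mapping.keys p. Poly_Mapping.keys m \<subseteq> {..<r}}"
  have add: "p + q \<in> ?C" if "p \<in> ?C" "q \<in> ?C" for p q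
    using that Poly_Mapping.keys_add[of p q] by blast
  have mult: "p * q \<in> ?C" if "p \<in> ?C" "q \<in> ?C" for p q
  proof (intro CollectI ballI)
    fix m assume "m \<in> Poly_Mapping.keys (p * q)"
    then obtain a b where "a \<in> Poly_Mapping.keys p" "b \<in> Poly_Mapping.keys q" "m = a + b"
      using Poly_Mapping.keys_mult[of p q] by blast
    then show "Poly_Mapping.keys m \<subseteq> {..<r}"
      using that Poly_Mapping.keys_add[of a b] by blast
  qed
  have neg: "- p \<in> ?C" if "p \<in> ?C" for p
    using that by simp
  show "abelian_group (poly_ring r :: 'k mpoly ring)"
  proof (rule abelian_groupI, goal_cases)
    case (1 p q)
    then show ?case using add[of p q] by (simp add: poly_ring_def)
  next
    case (6 p)
    then show ?case using neg[of p] by (intro bexI[of _ "- p"]) (simp_all add: poly_ring_def)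
  qed (simp_all add: poly_ring_def add.assoc add.commute)
  show "Group.comm_monoid (poly_ring r :: 'k mpoly ring)"
  proof (rule comm_monoidI, goal_cases)
    case (1 p q)
    then show ?case using mult[of p q] by (simp add: poly_ring_def)
  qed (simp_all add: poly_ring_def mult.assoc mult.commute)
qed (simp add: poly_ring_def distrib_right)

definition forms :: "nat \<Rightarrow> nat \<Rightarrow> 'k::field_char_0 mpoly set" where
  "forms r d = {p \<in> carrier (poly_ring r). \<forall>m\<in>Poly_Mapping.keys p. mono_deg m = d}"

definition hom_component :: "nat \<Rightarrow> 'k::field_char_0 mpoly \<Rightarrow> 'k mpoly" where
  "hom_component d p =
    (\<Sum>m | m \<in> Poly_Mapping.keys p \<and> mono_deg m = d.
      Poly_Mapping.single m (Poly_Mapping.lookup p m))"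

definition homogeneous_ideal :: "nat \<Rightarrow> 'k::field_char_0 mpoly set \<Rightarrow> bool" where
  "homogeneous_ideal r I \<longleftrightarrow>
    ideal I (poly_ring r) \<and> (\<forall>p\<in>I. \<forall>d. hom_component d p \<in> I)"


section \<open>Standard graded artinian algebras\<close>

text \<open>The algebra \<open>A = R/I\<close> is given by the pair of \<open>r\<close> and \<open>I\<close>.\<close>

definition quot_alg :: "nat \<Rightarrow> 'k::field_char_0 mpoly set \<Rightarrow> 'k mpoly set ring" where
  "quot_alg r I = poly_ring r Quot I"

definition quot_map :: "nat \<Rightarrow> 'k::field_char_0 mpoly set \<Rightarrow> 'k mpoly \<Rightarrow> 'k mpoly set" where
  "quot_map r I p = I +>\<^bsub>poly_ring r\<^esub> p"

definition base_field :: "nat \<Rightarrow> 'k::field_char_0 mpoly set \<Rightarrow> 'k mpoly set set" where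
  "base_field r I = quot_map r I ` range const_poly"

definition graded_piece :: "nat \<Rightarrow> 'k::field_char_0 mpoly set \<Rightarrow> nat \<Rightarrow> 'k mpoly set set" where
  "graded_piece r I d = quot_map r I ` forms r d"

text \<open>Dimension over \<open>k\<close> of a subspace of \<open>A\<close>, the scalars being the image of \<open>k\<close> in \<open>A\<close>.\<close>

definition dim_k :: "nat \<Rightarrow> 'k::field_char_0 mpoly set \<Rightarrow> 'k mpoly set set \<Rightarrow> nat" where
  "dim_k r I V = ring.dim (quot_alg r I) (base_field r I) V"

definition artinian_ring :: "('a, 'b) ring_scheme \<Rightarrow> bool" where
  "artinian_ring A \<longleftrightarrow> ring A \<and>
    (\<forall>J :: nat \<Rightarrow> 'a set. (\<forall>n. ideal (J n) A) \<and> (\<forall>n. J (Suc n) \<subseteq> J n) \<longrightarrow>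
      (\<exists>N. \<forall>n\<ge>N. J n = J N))"

text \<open>
  \<open>graded_artinian_alg r I e\<close>: \<open>R/I\<close> is one of the algebras considered here, and \<open>e \<ge> 1\<close> is
  the last degree in which it is nonzero. Since \<open>I\<close> contains no nonzero linear form, \<open>r\<close> is
  the codimension.
\<close>

definition graded_artinian_alg :: "nat \<Rightarrow> 'k::field_char_0 mpoly set \<Rightarrow> nat \<Rightarrow> bool" where
  "graded_artinian_alg r I e \<longleftrightarrow>
    homogeneous_ideal r I \<and>
    I \<inter> forms r 1 = {0} \<and>
    artinian_ring (quot_alg r I) \<and>
    e \<ge> 1 \<and>
    graded_piece r I e \<noteq> {\<zero>\<^bsub>quot_alg r I\<^esub>} \<and>
    (\<forall>i>e. graded_piece r I i = {\<zero>\<^bsub>quot_alg r I\<^esub>})"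

definition max_ideal :: "nat \<Rightarrow> 'k::field_char_0 mpoly set \<Rightarrow> 'k mpoly set set" where
  "max_ideal r I = genideal (quot_alg r I) ((\<lambda>i. quot_map r I (var_poly i)) ` {..<r})"

definition socle :: "nat \<Rightarrow> 'k::field_char_0 mpoly set \<Rightarrow> 'k mpoly set set" where
  "socle r I = {a \<in> carrier (quot_alg r I).
    \<forall>b\<in>max_ideal r I. a \<otimes>\<^bsub>quot_alg r I\<^esub> b = \<zero>\<^bsub>quot_alg r I\<^esub>}"


section \<open>h-vectors and socle-vectors\<close>

text \<open>
  A tuple indexed by \<open>0, \<dots>, e\<close> is a list of length \<open>e + 1\<close>. The entrywise order on tuples of
  the same length is \<open>list_all2 (\<le>)\<close>, which is false for lists of different lengths.
\<close>

definition h_vec :: "nat \<Rightarrow> 'k::field_char_0 mpoly set \<Rightarrow> nat \<Rightarrow> nat list" where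
  "h_vec r I e = map (\<lambda>i. dim_k r I (graded_piece r I i)) [0..<Suc e]"

definition socle_vec :: "nat \<Rightarrow> 'k::field_char_0 mpoly set \<Rightarrow> nat \<Rightarrow> nat list" where
  "socle_vec r I e = map (\<lambda>i. dim_k r I (socle r I \<inter> graded_piece r I i)) [0..<Suc e]"

definition is_h_vector :: "'k::field_char_0 itself \<Rightarrow> nat list \<Rightarrow> bool" where
  "is_h_vector k h \<longleftrightarrow>
    (\<exists>r (I :: 'k mpoly set) e. graded_artinian_alg r I e \<and> h_vec r I e = h)"

definition is_socle_vector :: "'k::field_char_0 itself \<Rightarrow> nat list \<Rightarrow> bool" where
  "is_socle_vector k s \<longleftrightarrow>
    (\<exists>r (I :: 'k mpoly set) e. graded_artinian_alg r I e \<and> socle_vec r I e = s)"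

definition h_vectors_for :: "'k::field_char_0 itself \<Rightarrow> nat list \<Rightarrow> nat list set" where
  "h_vectors_for k s =
    {h_vec r I e | r (I :: 'k mpoly set) e. graded_artinian_alg r I e \<and> socle_vec r I e = s}"

definition socle_vectors_for :: "'k::field_char_0 itself \<Rightarrow> nat list \<Rightarrow> nat list set" where
  "socle_vectors_for k h =
    {socle_vec r I e | r (I :: 'k mpoly set) e. graded_artinian_alg r I e \<and> h_vec r I e = h}"

definition is_min_h_vector :: "'k::field_char_0 itself \<Rightarrow> nat list \<Rightarrow> nat list \<Rightarrow> bool" where
  "is_min_h_vector k s h \<longleftrightarrow>
    h \<in> h_vectors_for k s \<and> (\<forall>h'\<in>h_vectors_for k s. list_all2 (\<le>) h h')"

definition is_max_socle_vector :: "'k::field_char_0 itself \<Rightarrow> nat list \<Rightarrow> nat list \<Rightarrow> bool" where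
  "is_max_socle_vector k h s \<longleftrightarrow>
    s \<in> socle_vectors_for k h \<and> (\<forall>s'\<in>socle_vectors_for k h. list_all2 (\<le>) s' s)"

definition min_codim :: "'k::field_char_0 itself \<Rightarrow> nat list \<Rightarrow> nat" where
  "min_codim k s =
    (LEAST r. \<exists>(I :: 'k mpoly set) e. graded_artinian_alg r I e \<and> socle_vec r I e = s)"


section \<open>Binomial expansions\<close>

text \<open>
  \<open>is_binomial_expansion n i j c\<close>: \<open>n\<close> is the sum of the \<open>c l choose l\<close> for \<open>l = i, i-1, \<dots>, j\<close>,
  where \<open>c i > c (i-1) > \<dots> > c j \<ge> j \<ge> 1\<close>. Values of \<open>c\<close> outside \<open>{j..i}\<close> are irrelevant.
\<close>

definition is_binomial_expansion :: "nat \<Rightarrow> nat \<Rightarrow> nat \<Rightarrow> (nat \<Rightarrow> nat) \<Rightarrow> bool" where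
  "is_binomial_expansion n i j c \<longleftrightarrow>
    1 \<le> j \<and> j \<le> i \<and> j \<le> c j \<and> (\<forall>l. j \<le> l \<and> l < i \<longrightarrow> c l < c (Suc l)) \<and>
    n = (\<Sum>l=j..i. c l choose l)"

text \<open>
  \<open>binomial_shift n i a\<close> is \<open>(n\<^sub>(\<^sub>i\<^sub>))\<^sub>a\<^sup>a\<close> for positive \<open>n\<close> and \<open>i\<close> (unspecified for
  \<open>n = 0\<close> or \<open>i = 0\<close>): \<open>a\<close> is added to both entries of every binomial coefficient of the
  expansion. A coefficient whose lower entry becomes negative is zero; otherwise its upper
  entry is nonnegative as well, because \<open>c l \<ge> l\<close>.
\<close>

definition binomial_shift :: "nat \<Rightarrow> nat \<Rightarrow> int \<Rightarrow> nat" where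
  "binomial_shift n i a =
    (THE v. \<exists>j c. is_binomial_expansion n i j c \<and>
      v = (\<Sum>l=j..i. if int l + a < 0 then 0 else nat (int (c l) + a) choose nat (int l + a)))"

end

theory Submission
  imports Defs
begin

text \<open>
  The theorem rests on one inequality between \<open>h\<close> and \<open>s\<close> and on monomial algebras for which the
  inequality is an equality in every degree.

  The inequality. Fix a total order on monomials that is compatible with multiplication. Let \<open>N\<^sub>i\<close> be
  the set of monomials of degree \<open>i\<close> that are not leading monomials of forms in \<open>I\<close>; their classes
  are a basis of \<open>A\<^sub>i\<close>, so \<open>N\<^sub>i\<close> has \<open>h\<^sub>i\<close> elements. The socle in degree \<open>i\<close> is the image of the space
  \<open>K\<^sub>i\<close> of forms \<open>f\<close> of degree \<open>i\<close> with \<open>x\<^sub>j f\<close> in \<open>I\<close> for all \<open>j\<close>, and \<open>s\<^sub>i\<close> is the number of leading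
  monomials of \<open>K\<^sub>i\<close> that lie in \<open>N\<^sub>i\<close>. If \<open>m\<close> is the leading monomial of a form in \<open>K\<^sub>i\<close>, then each
  \<open>x\<^sub>j m\<close> is the leading monomial of a form in \<open>I\<close>. Hence the monomials that arise from \<open>N\<^sub>i\<^sub>+\<^sub>1\<close> by
  division by one variable, the shadow of \<open>N\<^sub>i\<^sub>+\<^sub>1\<close>, lie in \<open>N\<^sub>i\<close> and are different from those counted
  by \<open>s\<^sub>i\<close>. So the size of the shadow plus \<open>s\<^sub>i\<close> is at most \<open>h\<^sub>i\<close>. This is
  \<open>min_shadow_add_socle_le\<close>.

  Macaulay's theorem, in the form \<open>min_shadow_le_card_shadow\<close>, says that \<open>n\<close> monomials of degree \<open>d\<close>
  have a shadow of at least \<open>min_shadow d n\<close> elements, and this number is the binomial shift of \<open>n\<close>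
  by \<open>-1\<close> (\<open>binomial_shift_eq_min_shadow\<close>). The proof splits a set of monomials by divisibility by
  one variable and reduces the claim to the numerical inequality \<open>min_shadow_split\<close>.

  Equality. The first \<open>n\<close> monomials of degree \<open>d\<close>, in an order that lists the monomials in few
  variables first, have a shadow of the smallest possible size, and the shadow is again such an
  initial segment (\<open>shadow_init_seg\<close>). If \<open>h\<close> satisfies the growth condition that \<open>h\<^sub>i\<close> is at least
  the binomial shift of \<open>h\<^sub>i\<^sub>+\<^sub>1\<close>, then the initial segments with \<open>h\<^sub>i\<close> elements are closed under
  division, and the monomials outside them span an ideal whose quotient has \<open>h\<close>-vector \<open>h\<close> and equality
  in the inequality above (\<open>algebra_with_h_vector\<close>).

  A socle-vector determines by descending recursion exactly one \<open>h\<close> with equality in all degrees, and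
  an \<open>h\<close>-vector determines exactly one \<open>s\<close>. Since \<open>min_shadow\<close> is monotone, equality forces \<open>h\<close> to be
  minimal for \<open>s\<close> and \<open>s\<close> to be maximal for \<open>h\<close>. Both conditions thus describe the same pairs
  (\<open>extremal_pair\<close>), which also gives the equivalence in the third part.
\<close>

section \<open>Numerical form of minimal shadows\<close>

text \<open>
  The number of monomials of degree \<open>d\<close> in \<open>a\<close> variables. For \<open>a = 0\<close> the truncated subtraction gives
  the right value: one if \<open>d = 0\<close> and none otherwise.
\<close>

definition mono_count :: "nat \<Rightarrow> nat \<Rightarrow> nat" where
  "mono_count d a = (a + d - 1) choose d"

lemma mono_count_0 [simp]: "mono_count 0 a = 1"
  by (simp add: mono_count_def)

lemma mono_count_Suc_0 [simp]: "mono_count (Suc d) 0 = 0"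
  by (simp add: mono_count_def binomial_eq_0)

lemma mono_count_Suc_Suc:
  "mono_count (Suc d) (Suc a) = mono_count (Suc d) a + mono_count d (Suc a)"
  by (simp add: mono_count_def)

lemma mono_count_Suc_pos [simp]: "0 < mono_count d (Suc a)"
  by (simp add: mono_count_def)

lemma mono_count_1_right [simp]: "mono_count d (Suc 0) = 1"
  by (simp add: mono_count_def)

lemma mono_count_1_left [simp]: "mono_count (Suc 0) a = a"
  by (induction a) (simp_all add: mono_count_Suc_Suc)

lemma mono_count_mono: "a \<le> b \<Longrightarrow> mono_count d a \<le> mono_count d b"
  by (simp add: mono_count_def binomial_right_mono)

lemma le_mono_count: "a \<le> mono_count (Suc d) a"
proof (induction a)
  case (Suc a)
  then show ?case using mono_count_Suc_pos[of d a] by (simp add: mono_count_Suc_Suc del: mono_count_Suc_pos)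
qed simp

text \<open>
  Sort the monomials of degree \<open>Suc d\<close> by their last variable. Block \<open>a\<close> consists of the multiples
  of \<open>x\<^sub>a\<close> by monomials of degree \<open>d\<close> in \<open>x\<^sub>0, \<dots>, x\<^sub>a\<close>, and \<open>mono_count (Suc d) a\<close> monomials come before
  it. Thus \<open>a\<close> is the block that contains the monomial number \<open>n\<close> (counted from zero) and \<open>n'\<close> is
  its position in this block.
\<close>

lemma mono_count_block:
  obtains a n' where "n = mono_count (Suc d) a + n'" "n' < mono_count d (Suc a)"
proof -
  have "\<exists>a n'. n = mono_count (Suc d) a + n' \<and> n' < mono_count d (Suc a)"
  proof (induction n)
    case 0
    then show ?case by (intro exI[of _ 0]) simp
  next
    case (Suc n)
    then obtain a n' where n: "n = mono_count (Suc d) a + n'" "n' < mono_count d (Suc a)" by blast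
    show ?case
    proof (cases "Suc n' < mono_count d (Suc a)")
      case True
      then show ?thesis using n by (intro exI[of _ a] exI[of _ "Suc n'"]) simp
    next
      case False
      then have "Suc n = mono_count (Suc d) (Suc a)" using n by (simp add: mono_count_Suc_Suc)
      then show ?thesis by (intro exI[of _ "Suc a"] exI[of _ 0]) simp
    qed
  qed
  then show thesis using that by blast
qed

lemma Greatest_mono_count_block:
  assumes "n' < mono_count d (Suc a)"
  shows "(GREATEST b. mono_count (Suc d) b \<le> mono_count (Suc d) a + n') = a"
proof (rule Greatest_equality)
  fix b assume b: "mono_count (Suc d) b \<le> mono_count (Suc d) a + n'"
  show "b \<le> a"
  proof (rule ccontr)
    assume "\<not> b \<le> a"
    then have "mono_count (Suc d) (Suc a) \<le> mono_count (Suc d) b"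
      by (intro mono_count_mono) simp
    then show False using b assms by (simp add: mono_count_Suc_Suc)
  qed
qed simp

text \<open>
  The size of the shadow of the first \<open>n\<close> monomials, in an order by blocks that is continued
  recursively inside each block. The complete blocks before block \<open>a\<close> form the set of all monomials
  in \<open>a\<close> variables, whose shadow has \<open>mono_count d a\<close> elements; the beginning of block \<open>a\<close> adds the
  multiples of \<open>x\<^sub>a\<close> by the shadow of an initial segment of degree \<open>d\<close>. The case \<open>n = 0\<close> needs its own
  clause because \<open>mono_count 0 0 = 1\<close>, while the shadow of the empty set is empty.
\<close>

fun min_shadow :: "nat \<Rightarrow> nat \<Rightarrow> nat" where
  "min_shadow 0 n = 0"
| "min_shadow (Suc d) n =
    (if n = 0 then 0 else
      let a = (GREATEST a. mono_count (Suc d) a \<le> n)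
      in mono_count d a + min_shadow d (n - mono_count (Suc d) a))"

declare min_shadow.simps(2) [simp del]

lemma min_shadow_zero [simp]: "min_shadow d 0 = 0"
  by (cases d) (simp_all add: min_shadow.simps)

lemma min_shadow_block_less:
  assumes "n' < mono_count d (Suc a)" "0 < mono_count (Suc d) a + n'"
  shows "min_shadow (Suc d) (mono_count (Suc d) a + n') = mono_count d a + min_shadow d n'"
  using Greatest_mono_count_block[OF assms(1)] assms(2) by (auto simp: min_shadow.simps)

lemma min_shadow_full: "min_shadow (Suc d) (mono_count (Suc d) (Suc a)) = mono_count d (Suc a)"
  using min_shadow_block_less[of 0 d "Suc a"] by simp

text \<open>
  The recursion also holds when block \<open>a\<close> is complete, where the defining equation would already use
  block \<open>Suc a\<close>. This uniform version makes the beginning and the end of a block interchangeable.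
\<close>

lemma min_shadow_block:
  assumes "n' \<le> mono_count d (Suc a)" "0 < mono_count (Suc d) a + n'"
  shows "min_shadow (Suc d) (mono_count (Suc d) a + n') = mono_count d a + min_shadow d n'"
proof (cases "n' = mono_count d (Suc a)")
  case True
  have "mono_count d (Suc a) = mono_count d a + min_shadow d (mono_count d (Suc a))"
  proof (cases d)
    case (Suc c)
    then show ?thesis using min_shadow_full[of c a] mono_count_Suc_Suc[of c a] by simp
  qed simp
  then show ?thesis using True min_shadow_full[of d a] by (simp add: mono_count_Suc_Suc)
qed (use assms min_shadow_block_less in simp)

lemma min_shadow_block_le:
  assumes "n' \<le> mono_count d (Suc a)"
  shows "min_shadow (Suc d) (mono_count (Suc d) a + n') \<le> mono_count d a + min_shadow d n'"
  using min_shadow_block[OF assms] by (cases "0 < mono_count (Suc d) a + n'") auto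

text \<open>
  The shadow of an initial segment is obtained by dividing by \<open>x\<^sub>0\<close> those of its elements that are
  divisible by \<open>x\<^sub>0\<close>. So \<open>min_shadow d n\<close> counts multiples of \<open>x\<^sub>0\<close>, and each further monomial
  contributes at most one.
\<close>

lemma min_shadow_Suc: "min_shadow d n \<le> min_shadow d (Suc n) \<and> min_shadow d (Suc n) \<le> Suc (min_shadow d n)"
proof (induction d arbitrary: n)
  case (Suc d)
  obtain a n' where n: "n = mono_count (Suc d) a + n'" "n' < mono_count d (Suc a)"
    by (rule mono_count_block)
  show ?case
  proof (cases "n = 0")
    case True
    then show ?thesis using min_shadow_full[of d 0] by simp
  next
    case False
    then show ?thesis
      using Suc[of n'] min_shadow_block[of n' d a] min_shadow_block[of "Suc n'" d a] n by simp
  qed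
qed simp

lemma min_shadow_mono: "m \<le> n \<Longrightarrow> min_shadow d m \<le> min_shadow d n"
  using min_shadow_Suc by (blast intro: lift_Suc_mono_le)

lemma min_shadow_add_le: "min_shadow d (m + n) \<le> min_shadow d m + n"
proof (induction n)
  case (Suc n)
  then show ?case using min_shadow_Suc[of d "m + n"] by simp
qed simp

lemma min_shadow_le: "min_shadow d n \<le> n"
  using min_shadow_add_le[of d 0 n] by simp

lemma min_shadow_pos: "0 < n \<Longrightarrow> 0 < min_shadow (Suc d) n"
  using min_shadow_full[of d 0] min_shadow_mono[of 1 n "Suc d"] by simp

text \<open>
  Concavity in a coarse sense: moving elements from one initial segment to another until the second
  is full or the first is empty does not increase the total size of the shadows. The move is done in
  steps. By the induction hypothesis for degree \<open>d\<close>, the last incomplete block of the larger segment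
  is filled from the last block of the smaller one; the smaller segment shrinks at each step.
\<close>

lemma min_shadow_spread:
  assumes "x \<le> mono_count d a" "y \<le> mono_count d a"
  shows "min_shadow d (min (x + y) (mono_count d a)) + min_shadow d (x + y - mono_count d a)
    \<le> min_shadow d x + min_shadow d y"
  using assms
proof (induction d arbitrary: x y a)
  case (Suc d)
  let ?f = "min_shadow (Suc d)" and ?L = "mono_count (Suc d)"
  have main: "?f (min (x + y) (?L a)) + ?f (x + y - ?L a) \<le> ?f x + ?f y"
    if "y \<le> x" "x \<le> ?L a" for x y
    using that
  proof (induction y arbitrary: x rule: less_induct)
    case (less y)
    show ?case
    proof (cases "y = 0 \<or> x = ?L a")
      case True
      then show ?thesis using less.prems by auto
    next
      case False
      obtain b x' where x: "x = ?L b + x'" "x' < mono_count d (Suc b)"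
        by (rule mono_count_block)
      \<comment> \<open>Using \<open>y - 1\<close> yields a nonempty last block, possibly complete, so that \<open>y\<close> really decreases.\<close>
      obtain c y0 where y0: "y - 1 = ?L c + y0" "y0 < mono_count d (Suc c)"
        by (rule mono_count_block)
      define y' where "y' = Suc y0"
      have y: "y = ?L c + y'" "0 < y'" "y' \<le> mono_count d (Suc c)"
        using y0 False by (auto simp: y'_def)
      have "b < a"
        using x less.prems False mono_count_mono[of a b "Suc d"] by (cases "b < a") auto
      have "c \<le> b"
      proof (rule ccontr)
        assume "\<not> c \<le> b"
        then have "?L (Suc b) \<le> ?L c" by (intro mono_count_mono) simp
        then show False using x y less.prems by (simp add: mono_count_Suc_Suc)
      qed
      let ?M = "mono_count d (Suc b)"
      have M: "y' \<le> ?M" using y mono_count_mono[of "Suc c" "Suc b" d] \<open>c \<le> b\<close> by simp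
      \<comment> \<open>Fill block \<open>b\<close> of \<open>x\<close> with elements of block \<open>c\<close> of \<open>y\<close> as far as possible.\<close>
      define p where "p = min (x' + y') ?M"
      define q where "q = x' + y' - ?M"
      have pq: "p + q = x' + y'" "p \<le> ?M" "q < y'" "x' < p"
        using x y M by (auto simp: p_def q_def)
      have "?f (?L b + p) + ?f (?L c + q)
          \<le> mono_count d b + min_shadow d p + (mono_count d c + min_shadow d q)"
        using pq y by (intro add_mono min_shadow_block_le) auto
      also have "\<dots> \<le> mono_count d b + min_shadow d x' + (mono_count d c + min_shadow d y')"
        using Suc.IH[of x' "Suc b" y'] x M by (simp add: p_def q_def)
      also have "\<dots> = ?f x + ?f y"
      proof -
        have "0 < x" "0 < y" using False less.prems by auto
        then show ?thesis
          using x y min_shadow_block[of x' d b] min_shadow_block[of y' d c] by auto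
      qed
      finally have 1: "?f (?L b + p) + ?f (?L c + q) \<le> ?f x + ?f y" .
      have "?L b + p \<le> ?L a"
        using pq mono_count_mono[of "Suc b" a "Suc d"] \<open>b < a\<close> by (simp add: mono_count_Suc_Suc)
      then have 2: "?f (min (?L b + p + (?L c + q)) (?L a)) + ?f (?L b + p + (?L c + q) - ?L a)
         \<le> ?f (?L b + p) + ?f (?L c + q)"
        using pq x y less.prems by (intro less.IH) auto
      have "?L b + p + (?L c + q) = x + y" using pq x y by simp
      then show ?thesis using 1 2 by simp
    qed
  qed
  show ?case
    using main[of y x] main[of x y] Suc.prems by (cases "y \<le> x") (simp_all add: add.commute)
qed simp

lemma min_shadow_subadditive: "min_shadow d (x + y) \<le> min_shadow d x + min_shadow d y"
proof (cases d)
  case (Suc c)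
  let ?a = "x + y"
  have "x + y \<le> mono_count d ?a" using le_mono_count Suc by simp
  then show ?thesis using min_shadow_spread[of x d ?a y] by (simp add: min_def)
qed simp

text \<open>
  As \<open>min_shadow\<close> counts ones in a zero-one sequence, the claim bounds the number of ones in a window
  of length \<open>m\<close> that ends at position \<open>n\<close>. In degree \<open>Suc (Suc d)\<close> the bound on \<open>m\<close> forces the window to
  lie in the block of \<open>n\<close> and the block before it. Both blocks are initial segments in degree
  \<open>Suc d\<close>, so the claim becomes an inequality in that degree. It follows from the concavity lemma
  unless the window is long compared to the block; in that case it is the same claim one degree lower.
\<close>

lemma min_shadow_split_aux:
  "m < min_shadow (Suc d) n \<Longrightarrow>
    min_shadow (Suc d) n \<le> min_shadow (Suc d) (n - m) + min_shadow d m"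
proof (induction d arbitrary: m n)
  case 0
  have "min_shadow (Suc 0) n \<le> 1"
    using min_shadow_block[of 0 0 n] by (cases n) auto
  then have "m = 0" using 0 by linarith
  then show ?case by simp
next
  case (Suc d)
  let ?F = "min_shadow (Suc (Suc d))" and ?f = "min_shadow (Suc d)"
  obtain a n' where n: "n = mono_count (Suc (Suc d)) a + n'" "n' < mono_count (Suc d) (Suc a)"
    by (rule mono_count_block)
  let ?L = "mono_count (Suc d) a"
  have "n > 0" using Suc.prems by (cases n) auto
  have Fn: "?F n = ?L + ?f n'" using n \<open>n > 0\<close> by (simp add: min_shadow_block)
  show ?case
  proof (cases "m \<le> n'")
    case True
    have "?F (n - m) = ?L + ?f (n' - m)" if "n \<noteq> m"
      using True n that min_shadow_block[of "n' - m" "Suc d" a] by simp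
    moreover have "n \<noteq> m" using Suc.prems min_shadow_le[of "Suc (Suc d)" n] by simp
    ultimately show ?thesis using min_shadow_subadditive[of "Suc d" "n' - m" m] True Fn by simp
  next
    case False
    define t where "t = m - n'"
    have t: "m = n' + t" "0 < t" using False by (auto simp: t_def)
    \<comment> \<open>The window takes the last \<open>t\<close> elements of the preceding block, and \<open>t\<close> is less than its length \<open>?L\<close>.\<close>
    have tL: "t + n' < ?L + ?f n'" using Suc.prems Fn t by simp
    have tL': "t < ?L" using tL min_shadow_le[of "Suc d" n'] by simp
    obtain b where a: "a = Suc b" using tL' by (cases a) auto
    have "n - m = mono_count (Suc (Suc d)) b + (?L - t)"
      using n t tL' by (simp add: a mono_count_Suc_Suc)
    then have Fnm: "?F (n - m) = mono_count (Suc d) b + ?f (?L - t)"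
      using tL' a min_shadow_block[of "?L - t" "Suc d" b] by simp
    have fL: "?f ?L = mono_count d a" using a by (simp add: min_shadow_full)
    have Lb: "?L = mono_count (Suc d) b + mono_count d a" by (simp add: a mono_count_Suc_Suc)
    have "?f ?L + ?f n' \<le> ?f (?L - t) + ?f (n' + t)"
    proof (cases "n' + t \<le> ?L")
      case True
      have "n' + t + (?L - t) = ?L + n'" using tL' by simp
      then show ?thesis using min_shadow_spread[of "n' + t" "Suc d" a "?L - t"] True tL'
        by simp
    next
      case False
      \<comment> \<open>Comparing the last \<open>t\<close> elements before position \<open>?L\<close> with the \<open>t\<close> elements from \<open>n'\<close> on
        amounts to comparing the \<open>u\<close> elements before \<open>n'\<close> with the \<open>u\<close> elements from \<open>?L\<close> on.\<close>
      define u where "u = n' + t - ?L"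
      have u: "n' + t = ?L + u" "?L - t = n' - u" "u < ?f n'" "0 < u"
        using False tL tL' by (auto simp: u_def)
      have "?f n' \<le> mono_count d (Suc a)"
        using min_shadow_mono[of n' "mono_count (Suc d) (Suc a)" "Suc d"] n by (simp add: min_shadow_full)
      then have "?f (n' + t) = mono_count d a + min_shadow d u"
        using u by (simp add: min_shadow_block)
      then show ?thesis using Suc.IH[OF u(3)] fL u by simp
    qed
    then show ?thesis using Fn Fnm Lb fL t by simp
  qed
qed

text \<open>
  The right-hand side is a lower bound for the shadow of \<open>N\<^sub>0 \<union> x M\<close>, where \<open>N\<^sub>0\<close> consists of \<open>n\<close>
  monomials of degree \<open>Suc d\<close> without \<open>x\<close> and \<open>M\<close> of \<open>m\<close> monomials of degree \<open>d\<close>: this shadow contains \<open>M\<close>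
  and also the disjoint union of the shadow of \<open>N\<^sub>0\<close> and \<open>x\<close> times the shadow of \<open>M\<close>.
\<close>

lemma min_shadow_split:
  "min_shadow (Suc d) (n + m) \<le> max m (min_shadow (Suc d) n + min_shadow d m)"
  using min_shadow_split_aux[of m d "n + m"] by (cases "m < min_shadow (Suc d) (n + m)") auto

section \<open>Binomial expansions and minimal shadows\<close>

text \<open>
  Removing the top binomial coefficient of an expansion leaves the expansion of the remainder, which
  allows induction on the degree.
\<close>

lemma is_binomial_expansion_Suc:
  assumes "is_binomial_expansion n (Suc d) j c" "j \<noteq> Suc d"
  shows "is_binomial_expansion (n - (c (Suc d) choose Suc d)) d j c"
    and "c d < c (Suc d)" and "(c (Suc d) choose Suc d) \<le> n"
  using assms by (auto simp: is_binomial_expansion_def)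

lemma binomial_expansion_top: "is_binomial_expansion n d j c \<Longrightarrow> 0 < d \<and> d \<le> c d"
proof (induction d arbitrary: n)
  case (Suc d)
  show ?case
  proof (cases "j = Suc d")
    case False
    show ?thesis
      using Suc.IH[OF is_binomial_expansion_Suc(1)[OF Suc.prems False]]
        is_binomial_expansion_Suc(2)[OF Suc.prems False] by simp
  qed (use Suc.prems in \<open>simp add: is_binomial_expansion_def\<close>)
qed (auto simp: is_binomial_expansion_def)

text \<open>
  The strictly decreasing upper entries make an expansion smaller than the next value of its leading
  binomial coefficient. So the top entry is determined by \<open>n\<close>, and the expansion is the greedy one.
\<close>

lemma binomial_expansion_less: "is_binomial_expansion n d j c \<Longrightarrow> n < Suc (c d) choose d"
proof (induction d arbitrary: n)
  case (Suc d)
  show ?case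
  proof (cases "j = Suc d")
    case True
    then have "n = c (Suc d) choose Suc d" "Suc d \<le> c (Suc d)"
      using Suc.prems by (auto simp: is_binomial_expansion_def)
    then show ?thesis by simp
  next
    case False
    note * = is_binomial_expansion_Suc[OF Suc.prems False]
    have "n - (c (Suc d) choose Suc d) < Suc (c d) choose d" by (rule Suc.IH[OF *(1)])
    also have "\<dots> \<le> c (Suc d) choose d" using *(2) by (intro binomial_right_mono) simp
    finally show ?thesis using *(3) by simp
  qed
qed (auto simp: is_binomial_expansion_def)

text \<open>
  With \<open>c (Suc d) = a + Suc d\<close>, the leading binomial coefficient is \<open>mono_count (Suc d) (Suc a)\<close>, and the
  rest of the expansion is the position of \<open>n\<close> in block \<open>Suc a\<close>. Subtracting one from both entries
  turns this coefficient into \<open>mono_count d (Suc a)\<close>, as in the recursion for \<open>min_shadow\<close>.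
\<close>

lemma min_shadow_binomial_expansion:
  "is_binomial_expansion n d j c \<Longrightarrow> min_shadow d n = (\<Sum>l=j..d. (c l - 1) choose (l - 1))"
proof (induction d arbitrary: n)
  case (Suc d)
  have top: "Suc d \<le> c (Suc d)" using binomial_expansion_top[OF Suc.prems] by simp
  define a where "a = c (Suc d) - Suc d"
  have c: "c (Suc d) = a + Suc d" using top by (simp add: a_def)
  have full: "c (Suc d) choose Suc d = mono_count (Suc d) (Suc a)"
    "(c (Suc d) - 1) choose d = mono_count d (Suc a)"
    "c (Suc d) choose d = mono_count d (Suc (Suc a))"
    by (simp_all add: c mono_count_def)
  show ?case
  proof (cases "j = Suc d")
    case True
    then have "n = mono_count (Suc d) (Suc a)"
      using Suc.prems full by (auto simp: is_binomial_expansion_def)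
    then show ?thesis using True full by (simp add: min_shadow_full)
  next
    case False
    note * = is_binomial_expansion_Suc[OF Suc.prems False]
    define n' where "n' = n - (c (Suc d) choose Suc d)"
    have n: "n = mono_count (Suc d) (Suc a) + n'" using *(3) full by (simp add: n'_def)
    have "n' < Suc (c d) choose d" using binomial_expansion_less[OF *(1)] by (simp add: n'_def)
    also have "\<dots> \<le> c (Suc d) choose d" using *(2) by (intro binomial_right_mono) simp
    finally have "min_shadow (Suc d) n = mono_count d (Suc a) + min_shadow d n'"
      unfolding n using full mono_count_Suc_pos by (intro min_shadow_block) auto
    also have "min_shadow d n' = (\<Sum>l=j..d. (c l - 1) choose (l - 1))"
      unfolding n'_def by (rule Suc.IH[OF *(1)])
    finally show ?thesis
      using Suc.prems False full(2) by (simp add: is_binomial_expansion_def)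
  qed
qed (auto simp: is_binomial_expansion_def)

lemma binomial_expansion_exists: "0 < n \<Longrightarrow> 0 < d \<Longrightarrow> \<exists>j c. is_binomial_expansion n d j c"
proof (induction d arbitrary: n)
  case (Suc d)
  obtain a n' where n: "n = mono_count (Suc d) a + n'" "n' < mono_count d (Suc a)"
    by (rule mono_count_block)
  have "a > 0" using n Suc.prems by (cases a) auto
  have full: "mono_count (Suc d) a = (a + d) choose Suc d" "mono_count d (Suc a) = (a + d) choose d"
    by (simp_all add: mono_count_def)
  show ?case
  proof (cases "n' = 0")
    case True
    then have "is_binomial_expansion n (Suc d) (Suc d) (\<lambda>_. a + d)"
      using n full \<open>a > 0\<close> by (simp add: is_binomial_expansion_def)
    then show ?thesis by blast
  next
    case False
    then have "d > 0" using n by (cases d) auto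
    then obtain j c where c: "is_binomial_expansion n' d j c" using Suc.IH[of n'] False by auto
    have j: "1 \<le> j" "j \<le> d" "j \<le> c j" using c by (auto simp: is_binomial_expansion_def)
    have "c d choose d \<le> n'"
      using c by (cases d) (auto simp: is_binomial_expansion_def)
    have "c d < a + d"
    proof (rule ccontr)
      assume "\<not> c d < a + d"
      then have "(a + d) choose d \<le> c d choose d" by (intro binomial_right_mono) simp
      then show False using n full \<open>c d choose d \<le> n'\<close> by simp
    qed
    moreover have "(\<Sum>l=j..d. (if l = Suc d then a + d else c l) choose l) = n'"
      using c by (auto simp: is_binomial_expansion_def intro!: sum.cong)
    ultimately have "is_binomial_expansion n (Suc d) j (c(Suc d := a + d))"
      using c j n full by (auto simp: is_binomial_expansion_def less_Suc_eq)
    then show ?thesis by blast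
  qed
qed simp

text \<open>
  All expansions of \<open>n\<close> give the same shifted sum, since each of these sums is \<open>min_shadow d n\<close>. This
  makes the definite description in \<open>binomial_shift\<close> meaningful.
\<close>

theorem binomial_shift_eq_min_shadow:
  assumes "0 < n" "0 < d"
  shows "binomial_shift n d (-1) = min_shadow d n"
proof -
  have val: "(\<Sum>l=j..d. if int l + -1 < 0 then 0 else nat (int (c l) + -1) choose nat (int l + -1))
      = min_shadow d n" (is "?s j c = _") if "is_binomial_expansion n d j c" for j c
  proof -
    have "?s j c = (\<Sum>l=j..d. (c l - 1) choose (l - 1))"
    proof (rule sum.cong)
      fix l assume "l \<in> {j..d}"
      then have "1 \<le> l" using that by (auto simp: is_binomial_expansion_def)
      moreover have "nat (int x + -1) = x - 1" for x :: nat by simp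
      ultimately show "(if int l + -1 < 0 then 0 else nat (int (c l) + -1) choose nat (int l + -1))
        = (c l - 1) choose (l - 1)" by simp
    qed simp
    then show ?thesis using min_shadow_binomial_expansion[OF that] by simp
  qed
  obtain j c where "is_binomial_expansion n d j c" using binomial_expansion_exists[OF assms] by blast
  then show ?thesis unfolding binomial_shift_def
    using val by (intro the_equality) (metis (no_types, lifting))+
qed

section \<open>Shadows of sets of monomials\<close>

text \<open>
  The variable \<open>x\<^sub>i\<close> as a monomial. It is a constant of its own so that simplification does not rewrite
  the exponent \<open>1\<close> to \<open>Suc 0\<close>.
\<close>

definition mvar :: "nat \<Rightarrow> nat \<Rightarrow>\<^sub>0 nat" where
  "mvar i = Poly_Mapping.single i 1"

lemma keys_mvar [simp]: "Poly_Mapping.keys (mvar i) = {i}"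
  by (simp add: mvar_def)

definition monomials :: "nat \<Rightarrow> nat \<Rightarrow> (nat \<Rightarrow>\<^sub>0 nat) set" where
  "monomials d a = {m. mono_deg m = d \<and> Poly_Mapping.keys m \<subseteq> {..<a}}"

definition shadow :: "(nat \<Rightarrow>\<^sub>0 nat) set \<Rightarrow> (nat \<Rightarrow>\<^sub>0 nat) set" where
  "shadow N = {m. \<exists>i. m + mvar i \<in> N}"

lemma keys_add_mono: "Poly_Mapping.keys (m + n) = Poly_Mapping.keys m \<union> Poly_Mapping.keys n"
  for m n :: "nat \<Rightarrow>\<^sub>0 nat"
  by (auto simp: in_keys_iff lookup_add)

lemma mono_deg_add: "mono_deg (m + n) = mono_deg m + mono_deg n"
proof -
  have *: "mono_deg p = (\<Sum>i\<in>Poly_Mapping.keys m \<union> Poly_Mapping.keys n. Poly_Mapping.lookup p i)"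
    if "Poly_Mapping.keys p \<subseteq> Poly_Mapping.keys m \<union> Poly_Mapping.keys n" for p
    unfolding mono_deg_def using that by (intro sum.mono_neutral_left) (auto simp: in_keys_iff)
  show ?thesis
    using *[of "m + n"] *[of m] *[of n] by (simp add: keys_add_mono lookup_add sum.distrib)
qed

lemma mono_deg_mvar [simp]: "mono_deg (mvar i) = 1"
  by (simp add: mono_deg_def mvar_def)

lemma mono_deg_zero [simp]: "mono_deg 0 = 0"
  by (simp add: mono_deg_def)

lemma mono_deg_eq_0_iff [simp]: "mono_deg m = 0 \<longleftrightarrow> m = 0"
  by (auto simp: mono_deg_def in_keys_iff intro!: poly_mapping_eqI)

lemma minus_mvar_add: "i \<in> Poly_Mapping.keys m \<Longrightarrow> m - mvar i + mvar i = m"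
  by (intro poly_mapping_eqI) (auto simp: lookup_add lookup_minus lookup_single mvar_def in_keys_iff when_def)

lemma finite_shadow: "finite N \<Longrightarrow> finite (shadow N)"
proof (rule finite_subset)
  show "shadow N \<subseteq> (\<Union>m\<in>N. (\<lambda>i. m - mvar i) ` Poly_Mapping.keys m)"
  proof
    fix m assume "m \<in> shadow N"
    then obtain i where "m + mvar i \<in> N" by (auto simp: shadow_def)
    moreover have "m = m + mvar i - mvar i" "i \<in> Poly_Mapping.keys (m + mvar i)"
      by (simp_all add: keys_add_mono)
    ultimately show "m \<in> (\<Union>m\<in>N. (\<lambda>i. m - mvar i) ` Poly_Mapping.keys m)" by blast
  qed
qed auto

lemma shadow_Un: "shadow (A \<union> B) = shadow A \<union> shadow B"
  by (auto simp: shadow_def)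

lemma shadow_empty [simp]: "shadow {} = {}"
  by (simp add: shadow_def)

text \<open>
  Dividing \<open>x\<^sub>a p\<close> by a variable other than \<open>x\<^sub>a\<close> means dividing \<open>p\<close> by this variable.
\<close>

lemma shadow_mult_mvar: "shadow ((\<lambda>m. m + mvar a) ` X) = X \<union> (\<lambda>m. m + mvar a) ` shadow X"
proof (intro Set.set_eqI iffI)
  fix m assume "m \<in> shadow ((\<lambda>m. m + mvar a) ` X)"
  then obtain i p where p: "p \<in> X" "m + mvar i = p + mvar a" by (auto simp: shadow_def)
  show "m \<in> X \<union> (\<lambda>m. m + mvar a) ` shadow X"
  proof (cases "i = a")
    case True
    then show ?thesis using p by simp
  next
    case False
    have "a \<in> Poly_Mapping.keys (m + mvar i)" unfolding p(2) by (simp add: keys_add_mono)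
    then have m: "m = (m - mvar a) + mvar a"
      using False minus_mvar_add[of a m] by (simp add: keys_add_mono)
    then have "(m - mvar a) + mvar i + mvar a = p + mvar a" using p(2) by (metis add.commute add.left_commute)
    then have "(m - mvar a) + mvar i = p" by simp
    then show ?thesis using m p(1) by (auto simp: shadow_def)
  qed
next
  fix m assume "m \<in> X \<union> (\<lambda>m. m + mvar a) ` shadow X"
  then show "m \<in> shadow ((\<lambda>m. m + mvar a) ` X)"
  proof
    assume "m \<in> (\<lambda>m. m + mvar a) ` shadow X"
    then obtain p i where "m = p + mvar a" "p + mvar i \<in> X" by (auto simp: shadow_def)
    moreover from this have "m + mvar i = p + mvar i + mvar a" by (simp add: ac_simps)
    ultimately show ?thesis unfolding shadow_def by blast
  qed (auto simp: shadow_def)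
qed

text \<open>
  Macaulay's theorem on the growth of Hilbert functions, in the form of a bound for shadows. Choose a
  variable \<open>x\<close> that occurs in \<open>N\<close> and write \<open>N = N\<^sub>0 \<union> x M\<close>, where \<open>N\<^sub>0\<close> is free of \<open>x\<close>. Then \<open>N\<^sub>0\<close> is
  smaller than \<open>N\<close> and \<open>M\<close> has smaller degree, so the bound holds for both, and
  \<open>min_shadow_split\<close> combines the two bounds.
\<close>

theorem min_shadow_le_card_shadow:
  assumes "finite N" "\<And>m. m \<in> N \<Longrightarrow> mono_deg m = d"
  shows "min_shadow d (card N) \<le> card (shadow N)"
  using assms
proof (induction d arbitrary: N)
  case (Suc d N)
  show ?case
    using Suc.prems
  proof (induction "card N" arbitrary: N rule: less_induct)
    case less
    show ?case
    proof (cases "N = {}")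
      case False
      then obtain p where p: "p \<in> N" by blast
      then have "p \<noteq> 0" using less.prems(2)[of p] by auto
      then obtain i where i: "i \<in> Poly_Mapping.keys p" by (metis all_not_in_conv keys_eq_empty)
      let ?x = "\<lambda>m. m + mvar i"
      define M where "M = {m. ?x m \<in> N}"
      define N0 where "N0 = {m \<in> N. i \<notin> Poly_Mapping.keys m}"
      have inj: "inj_on ?x A" for A by (auto simp: inj_on_def)
      have N: "N = N0 \<union> ?x ` M"
      proof (intro Set.set_eqI iffI)
        fix m assume "m \<in> N"
        then show "m \<in> N0 \<union> ?x ` M"
          using minus_mvar_add[of i m] by (cases "i \<in> Poly_Mapping.keys m") (auto simp: N0_def M_def image_iff, metis)
      qed (auto simp: N0_def M_def)
      have disj: "A \<inter> ?x ` B = {}" if "\<And>m. m \<in> A \<Longrightarrow> i \<notin> Poly_Mapping.keys m" for A B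
        using that keys_add_mono[of _ "mvar i"] by fastforce
      have fin: "finite N0" "finite M"
        using less.prems(1) N inj by (auto simp: finite_image_iff)
      have "N0 \<inter> ?x ` M = {}" by (rule disj) (simp add: N0_def)
      then have "card (N0 \<union> ?x ` M) = card N0 + card (?x ` M)"
        using fin by (intro card_Un_disjoint) auto
      then have card: "card N = card N0 + card M"
        unfolding N[symmetric] by (simp only: card_image[OF inj])
      have "p - mvar i \<in> M" using p minus_mvar_add[OF i] by (simp add: M_def)
      then have "M \<noteq> {}" by blast
      then have lt: "card N0 < card N" using card fin by (simp add: card_gt_0_iff)
      have 0: "min_shadow (Suc d) (card N0) \<le> card (shadow N0)"
        using less.prems fin by (intro less.hyps[OF lt]) (auto simp: N0_def)
      have "mono_deg m = d" if "m \<in> M" for m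
        using that less.prems(2)[of "?x m"] by (simp add: M_def mono_deg_add)
      then have 1: "min_shadow d (card M) \<le> card (shadow M)"
        using fin by (intro Suc.IH) auto
      have sh: "shadow N = shadow N0 \<union> (M \<union> ?x ` shadow M)"
        by (subst N) (simp only: shadow_Un shadow_mult_mvar)
      have "\<And>m. m \<in> shadow N0 \<Longrightarrow> i \<notin> Poly_Mapping.keys m"
        by (auto simp: shadow_def N0_def keys_add_mono)
      then have "card (shadow N0) + card (shadow M) = card (shadow N0 \<union> ?x ` shadow M)"
        using fin disj[of "shadow N0" "shadow M"]
        by (simp add: card_Un_disjoint finite_shadow card_image[OF inj])
      also have "\<dots> \<le> card (shadow N)"
        using less.prems(1) sh by (intro card_mono finite_shadow) auto
      finally have "card (shadow N0) + card (shadow M) \<le> card (shadow N)" .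
      moreover have "card M \<le> card (shadow N)"
        using less.prems(1) sh by (intro card_mono finite_shadow) auto
      ultimately show ?thesis
        using min_shadow_split[of d "card N0" "card M"] 0 1 card by simp
    qed simp
  qed
qed simp

lemma monomials_0 [simp]: "monomials 0 a = {0}"
  by (auto simp: monomials_def)

lemma monomials_Suc_0 [simp]: "monomials (Suc d) 0 = {}"
  by (auto simp: monomials_def)

lemma monomials_Suc_Suc:
  "monomials (Suc d) (Suc a) = monomials (Suc d) a \<union> (\<lambda>m. m + mvar a) ` monomials d (Suc a)"
proof (intro Set.set_eqI iffI)
  fix m assume m: "m \<in> monomials (Suc d) (Suc a)"
  show "m \<in> monomials (Suc d) a \<union> (\<lambda>m. m + mvar a) ` monomials d (Suc a)"
  proof (cases "a \<in> Poly_Mapping.keys m")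
    case True
    note eq = minus_mvar_add[OF True]
    have "m - mvar a \<in> monomials d (Suc a)"
      using m mono_deg_add[of "m - mvar a" "mvar a"] keys_add_mono[of "m - mvar a" "mvar a"]
      by (simp add: monomials_def eq)
    then show ?thesis using eq by (metis UnI2 image_eqI)
  next
    case False
    then show ?thesis using m by (auto simp: monomials_def less_Suc_eq subset_iff)
  qed
qed (auto simp: monomials_def mono_deg_add keys_add_mono less_Suc_eq)

lemma card_monomials: "finite (monomials d a) \<and> card (monomials d a) = mono_count d a"
proof (induction d arbitrary: a)
  case (Suc d)
  show ?case
  proof (induction a)
    case (Suc a)
    have "monomials (Suc d) a \<inter> (\<lambda>m. m + mvar a) ` monomials d (Suc a) = {}"
      by (auto simp: monomials_def keys_add_mono)
    then show ?case using Suc.IH \<open>\<And>a. finite (monomials d a) \<and> card (monomials d a) = mono_count d a\<close>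
      by (simp add: monomials_Suc_Suc mono_count_Suc_Suc card_Un_disjoint card_image inj_on_def)
  qed simp
qed simp

lemmas finite_monomials [simp] = card_monomials[THEN conjunct1]

lemma shadow_monomials: "0 < a \<or> 0 < d \<Longrightarrow> shadow (monomials (Suc d) a) = monomials d a"
proof (intro equalityI subsetI)
  fix m assume "0 < a \<or> 0 < d" "m \<in> monomials d a"
  moreover have "\<exists>i. i < a" if "0 < a \<or> 0 < d" "m \<in> monomials d a"
    using that by (cases a) (auto simp: monomials_def)
  ultimately obtain i where "i < a" by blast
  then have "m + mvar i \<in> monomials (Suc d) a"
    using \<open>m \<in> monomials d a\<close> by (simp add: monomials_def mono_deg_add keys_add_mono)
  then show "m \<in> shadow (monomials (Suc d) a)" by (auto simp: shadow_def)
qed (auto simp: shadow_def monomials_def mono_deg_add keys_add_mono)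

text \<open>
  The first \<open>n\<close> monomials of degree \<open>d\<close> in the order that underlies \<open>min_shadow\<close>: all complete blocks
  before block \<open>a\<close>, followed by an initial segment of block \<open>a\<close>. In degree \<open>0\<close> there is only one
  monomial, so every positive \<open>n\<close> gives the same set.
\<close>

fun init_seg :: "nat \<Rightarrow> nat \<Rightarrow> (nat \<Rightarrow>\<^sub>0 nat) set" where
  "init_seg 0 n = (if n = 0 then {} else {0})"
| "init_seg (Suc d) n =
    (let a = (GREATEST a. mono_count (Suc d) a \<le> n)
     in monomials (Suc d) a \<union> (\<lambda>m. m + mvar a) ` init_seg d (n - mono_count (Suc d) a))"

declare init_seg.simps(2) [simp del]

lemma init_seg_block_less:
  assumes "n' < mono_count d (Suc a)"
  shows "init_seg (Suc d) (mono_count (Suc d) a + n')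
    = monomials (Suc d) a \<union> (\<lambda>m. m + mvar a) ` init_seg d n'"
  using Greatest_mono_count_block[OF assms] by (simp add: init_seg.simps)

lemma init_seg_zero [simp]: "init_seg d 0 = {}"
proof (induction d)
  case (Suc d)
  then show ?case using init_seg_block_less[of 0 d 0] by simp
qed simp

lemma init_seg_full: "init_seg d (mono_count d (Suc a)) = monomials d (Suc a)"
  by (cases d) (use init_seg_block_less[of 0 _ "Suc a"] in simp_all)

lemma init_seg_block:
  assumes "n' \<le> mono_count d (Suc a)"
  shows "init_seg (Suc d) (mono_count (Suc d) a + n')
    = monomials (Suc d) a \<union> (\<lambda>m. m + mvar a) ` init_seg d n'"
proof (cases "n' = mono_count d (Suc a)")
  case True
  then show ?thesis
    using init_seg_full[of "Suc d" a] init_seg_full[of d a] by (simp add: mono_count_Suc_Suc monomials_Suc_Suc)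
qed (use assms init_seg_block_less in simp)

lemma init_seg_Suc: "init_seg d n \<subseteq> init_seg d (Suc n)"
proof (induction d arbitrary: n)
  case (Suc d)
  obtain a n' where "n = mono_count (Suc d) a + n'" "n' < mono_count d (Suc a)"
    by (rule mono_count_block)
  then show ?case
    using Suc[of n'] init_seg_block[of n' d a] init_seg_block[of "Suc n'" d a] by auto
qed simp

lemma init_seg_mono: "m \<le> n \<Longrightarrow> init_seg d m \<subseteq> init_seg d n"
  using init_seg_Suc by (rule lift_Suc_mono_le)

lemma init_seg_subset_monomials: "n \<le> mono_count d a \<Longrightarrow> init_seg d n \<subseteq> monomials d a"
proof (cases a)
  case 0
  then show "n \<le> mono_count d a \<Longrightarrow> ?thesis" by (cases d) auto
qed (use init_seg_mono[of n "mono_count d a" d] init_seg_full in simp)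

lemma card_init_seg: "n \<le> mono_count d a \<Longrightarrow> card (init_seg d n) = n"
proof (induction d arbitrary: n a)
  case (Suc d)
  obtain b n' where n: "n = mono_count (Suc d) b + n'" "n' < mono_count d (Suc b)"
    by (rule mono_count_block)
  have sub: "init_seg d n' \<subseteq> monomials d (Suc b)" using n by (intro init_seg_subset_monomials) simp
  have "monomials (Suc d) b \<inter> (\<lambda>m. m + mvar b) ` init_seg d n' = {}"
    by (auto simp: monomials_def keys_add_mono)
  moreover have "card (init_seg d n') = n'" using n by (intro Suc.IH[of _ "Suc b"]) simp
  moreover have "finite (init_seg d n')" using sub finite_monomials by (rule finite_subset)
  ultimately show ?case
    using n card_monomials[of "Suc d" b]
    by (simp add: init_seg_block_less card_Un_disjoint card_image inj_on_def)
qed (simp split: if_splits)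

text \<open>
  By the block structure, the shadow of an initial segment is the union of an initial segment of
  \<open>n'\<close> monomials and one of \<open>mono_count (Suc d) a + min_shadow (Suc d) n'\<close> monomials. The second
  contains the first because \<open>n' - min_shadow (Suc d) n'\<close>, the number of those among the first \<open>n'\<close>
  monomials that are not divisible by \<open>x\<^sub>0\<close>, is monotone in \<open>n'\<close>.
\<close>

theorem shadow_init_seg: "shadow (init_seg (Suc d) n) = init_seg d (min_shadow (Suc d) n)"
proof (induction d arbitrary: n)
  case 0
  show ?case
  proof (cases n)
    case (Suc a)
    have "init_seg (Suc 0) n = monomials (Suc 0) n" using init_seg_full[of "Suc 0" a] Suc by simp
    moreover have "min_shadow (Suc 0) n = 1" using min_shadow_full[of 0 a] Suc by simp
    ultimately show ?thesis using Suc by (simp add: shadow_monomials)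
  qed simp
next
  case (Suc d)
  let ?D = "Suc d" and ?D' = "Suc (Suc d)"
  obtain a n' where n: "n = mono_count ?D' a + n'" "n' < mono_count ?D (Suc a)"
    by (rule mono_count_block)
  show ?case
  proof (cases "n = 0")
    case False
    let ?x = "\<lambda>m. m + mvar a" and ?s = "min_shadow ?D n'"
    obtain k where k: "mono_count ?D (Suc a) = n' + k" using n(2) less_imp_add_positive by metis
    have "mono_count d (Suc a) \<le> ?s + k"
      using min_shadow_add_le[of ?D n' k] min_shadow_full[of d a] by (simp add: k)
    then have le: "n' \<le> mono_count ?D a + ?s" using k by (simp add: mono_count_Suc_Suc)
    have s: "?s \<le> mono_count d (Suc a)"
      using min_shadow_mono[of n' "mono_count ?D (Suc a)" ?D] n by (simp add: min_shadow_full)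
    have "shadow (init_seg ?D' n) = monomials ?D a \<union> init_seg ?D n' \<union> ?x ` init_seg d ?s"
      using n Suc.IH[of n']
      by (simp add: init_seg_block_less shadow_Un shadow_mult_mvar shadow_monomials Un_assoc)
    also have "\<dots> = init_seg ?D n' \<union> init_seg ?D (mono_count ?D a + ?s)"
      using s by (auto simp: init_seg_block)
    also have "\<dots> = init_seg ?D (mono_count ?D a + ?s)"
      using init_seg_mono[OF le] by blast
    also have "mono_count ?D a + ?s = min_shadow ?D' n"
      using n False by (simp add: min_shadow_block)
    finally show ?thesis .
  qed simp
qed

section \<open>Leading monomials and dimensions in quotient algebras\<close>

text \<open>
  Multiplication by a term shifts and scales coefficients. This covers scalars, where \<open>a = 0\<close>, and
  variables.
\<close>

lemma lookup_single_mult: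
  fixes p :: "'k::field_char_0 mpoly"
  shows "Poly_Mapping.lookup (Poly_Mapping.single a c * p) (m + a) = c * Poly_Mapping.lookup p m"
proof (induction p rule: update_induct)
  case (update p b x)
  have "Poly_Mapping.update b x p = p + Poly_Mapping.single b x"
    using update(1) by (intro poly_mapping_eqI) (auto simp: lookup_update lookup_add lookup_single in_keys_iff)
  then show ?case
    using update.IH
    by (simp add: distrib_left mult_single lookup_add lookup_single when_def add.commute[of a])
qed simp

lemma lookup_const_poly_mult [simp]:
  "Poly_Mapping.lookup (const_poly c * p) m = c * Poly_Mapping.lookup p m"
  using lookup_single_mult[of 0 c p m] by (simp add: const_poly_def)

lemma const_poly_simps [simp]: "const_poly 0 = 0" "const_poly 1 = 1"
  by (simp_all add: const_poly_def single_one)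

lemma const_poly_add: "const_poly (c + d) = const_poly c + const_poly d"
  by (simp add: const_poly_def single_add)

lemma const_poly_mult: "const_poly (c * d) = const_poly c * const_poly d"
  by (simp add: const_poly_def mult_single)

lemma const_poly_uminus: "const_poly (- c) = - const_poly c"
  by (simp add: const_poly_def single_uminus)

lemma keys_var_poly_mult:
  "Poly_Mapping.keys (var_poly i * p) = (\<lambda>m. m + mvar i) ` Poly_Mapping.keys p"
proof
  show "Poly_Mapping.keys (var_poly i * p) \<subseteq> (\<lambda>m. m + mvar i) ` Poly_Mapping.keys p"
    using keys_mult[of "var_poly i" p] by (auto simp: var_poly_def mvar_def add.commute)
  show "(\<lambda>m. m + mvar i) ` Poly_Mapping.keys p \<subseteq> Poly_Mapping.keys (var_poly i * p)"
    using lookup_single_mult[of "mvar i" 1 p] by (auto simp: in_keys_iff var_poly_def mvar_def)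
qed

text \<open>
  Leading monomials are taken with respect to the lexicographic order on exponent vectors, which is
  compatible with addition. The value at the zero polynomial is meaningless.
\<close>

definition lead :: "'k::field_char_0 mpoly \<Rightarrow> (nat \<Rightarrow>\<^sub>0 nat)" where
  "lead p = Max (Poly_Mapping.keys p)"

definition lead_set :: "'k::field_char_0 mpoly set \<Rightarrow> (nat \<Rightarrow>\<^sub>0 nat) set" where
  "lead_set V = lead ` (V - {0})"

definition lin_subspace :: "'k::field_char_0 mpoly set \<Rightarrow> bool" where
  "lin_subspace V \<longleftrightarrow>
    0 \<in> V \<and> (\<forall>p\<in>V. \<forall>q\<in>V. p + q \<in> V) \<and> (\<forall>c. \<forall>p\<in>V. const_poly c * p \<in> V)"

lemma lead_in_keys: "p \<noteq> 0 \<Longrightarrow> lead p \<in> Poly_Mapping.keys p"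
  by (simp add: lead_def)

lemma lead_ge: "m \<in> Poly_Mapping.keys p \<Longrightarrow> m \<le> lead p"
  by (simp add: lead_def)

lemma lead_eqI:
  "m \<in> Poly_Mapping.keys p \<Longrightarrow> (\<And>n. n \<in> Poly_Mapping.keys p \<Longrightarrow> n \<le> m) \<Longrightarrow> lead p = m"
  unfolding lead_def by (intro Max_eqI) auto

lemma lead_var_poly_mult: "p \<noteq> 0 \<Longrightarrow> lead (var_poly i * p) = lead p + mvar i"
  by (rule lead_eqI) (auto simp: keys_var_poly_mult lead_in_keys lead_ge)

lemma var_poly_nonzero [simp]: "var_poly i \<noteq> 0"
  by (metis keys_eq_empty keys_single insert_not_empty var_poly_def zero_neq_one)

lemma lead_setI: "p \<in> V \<Longrightarrow> p \<noteq> 0 \<Longrightarrow> lead p \<in> lead_set V"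
  by (auto simp: lead_set_def)

lemma lead_set_mono: "U \<subseteq> V \<Longrightarrow> lead_set U \<subseteq> lead_set V"
  by (auto simp: lead_set_def)

lemma lin_subspaceD:
  assumes "lin_subspace V"
  shows "0 \<in> V" "p \<in> V \<Longrightarrow> q \<in> V \<Longrightarrow> p + q \<in> V" "p \<in> V \<Longrightarrow> const_poly c * p \<in> V"
    "p \<in> V \<Longrightarrow> - p \<in> V" "p \<in> V \<Longrightarrow> q \<in> V \<Longrightarrow> p - q \<in> V"
proof -
  show *: "0 \<in> V" "p \<in> V \<Longrightarrow> q \<in> V \<Longrightarrow> p + q \<in> V" "p \<in> V \<Longrightarrow> const_poly c * p \<in> V" for p q c
    using assms by (auto simp: lin_subspace_def)
  show neg: "p \<in> V \<Longrightarrow> - p \<in> V" for p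
    using *(3)[of p "- 1"] by (simp add: const_poly_uminus)
  show "p \<in> V \<Longrightarrow> q \<in> V \<Longrightarrow> p - q \<in> V"
    using *(2)[of p "- q"] neg[of q] by simp
qed

text \<open>
  Division with respect to a monomial order: subtracting suitable multiples of elements of \<open>U\<close>
  lowers the leading monomial of an element of \<open>V\<close> until nothing remains. The process ends because only
  finitely many leading monomials occur in \<open>V\<close>.
\<close>

lemma subspace_eq_if_lead_set_subset:
  assumes U: "lin_subspace U" and V: "lin_subspace V" and "U \<subseteq> V"
    and fin: "finite (lead_set V)" and le: "lead_set V \<subseteq> lead_set U"
  shows "U = V"
proof (intro equalityI[OF \<open>U \<subseteq> V\<close>] subsetI)
  fix v assume "v \<in> V"
  then show "v \<in> U"
  proof (induction "card {m \<in> lead_set V. m < lead v}" arbitrary: v rule: less_induct)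
    case less
    show ?case
    proof (cases "v = 0")
      case False
      then have "lead v \<in> lead_set U" using less.prems le lead_setI by blast
      then obtain u where u: "u \<in> U" "u \<noteq> 0" "lead u = lead v" unfolding lead_set_def by force
      define c where "c = Poly_Mapping.lookup v (lead v) / Poly_Mapping.lookup u (lead v)"
      define w where "w = v - const_poly c * u"
      have "w \<in> U"
      proof (cases "w = 0")
        case True
        then show ?thesis using lin_subspaceD(1)[OF U] by simp
      next
        case w: False
        have wV: "w \<in> V"
          unfolding w_def using V U less.prems u \<open>U \<subseteq> V\<close> by (blast intro: lin_subspaceD)
        have "Poly_Mapping.lookup u (lead v) \<noteq> 0" using lead_in_keys[OF u(2)] u(3) by (simp add: in_keys_iff)
        then have 0: "Poly_Mapping.lookup w (lead v) = 0" by (simp add: w_def c_def lookup_minus)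
        have "Poly_Mapping.keys w \<subseteq> Poly_Mapping.keys v \<union> Poly_Mapping.keys u"
          by (auto simp: w_def in_keys_iff lookup_minus)
        then have "lead w \<le> lead v" using lead_in_keys[OF w] lead_ge u(3) by fastforce
        moreover have "lead w \<noteq> lead v" using 0 lead_in_keys[OF w] by (auto simp: in_keys_iff)
        ultimately have "lead w < lead v" by simp
        then have "{m \<in> lead_set V. m < lead w} \<subset> {m \<in> lead_set V. m < lead v}"
          using lead_setI[OF wV w] by auto
        then show ?thesis using fin wV by (intro less.hyps psubset_card_mono) auto
      qed
      moreover have "v = w + const_poly c * u" by (simp add: w_def)
      ultimately show ?thesis using U u(1) by (metis lin_subspaceD(2,3))
    qed (use lin_subspaceD(1)[OF U] in simp)
  qed
qed

fun lspan :: "'k::field_char_0 mpoly list \<Rightarrow> 'k mpoly set" where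
  "lspan [] = {0}"
| "lspan (f # fs) = {const_poly c * f + g | c g. g \<in> lspan fs}"

lemma lspan_ConsI: "g \<in> lspan fs \<Longrightarrow> const_poly c * f + g \<in> lspan (f # fs)"
  by auto

lemma lspan_subset: "lin_subspace V \<Longrightarrow> set fs \<subseteq> V \<Longrightarrow> lspan fs \<subseteq> V"
  by (induction fs) (auto intro!: lin_subspaceD)

lemma lin_subspace_lspan: "lin_subspace (lspan fs)"
proof (induction fs)
  case (Cons f fs)
  note D = lin_subspaceD[OF Cons.IH]
  show ?case unfolding lin_subspace_def
  proof (intro conjI ballI allI)
    show "0 \<in> lspan (f # fs)" using lspan_ConsI[OF D(1), of 0 f] by simp
  next
    fix p q assume "p \<in> lspan (f # fs)" "q \<in> lspan (f # fs)"
    then obtain c g d h where "p = const_poly c * f + g" "q = const_poly d * f + h"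
      "g \<in> lspan fs" "h \<in> lspan fs" by auto
    moreover from this have "p + q = const_poly (c + d) * f + (g + h)"
      by (simp add: const_poly_add algebra_simps)
    ultimately show "p + q \<in> lspan (f # fs)"
      using lspan_ConsI[OF D(2)[of g h]] by metis
  next
    fix c p assume "p \<in> lspan (f # fs)"
    then obtain d g where "p = const_poly d * f + g" "g \<in> lspan fs" by auto
    moreover from this have "const_poly c * p = const_poly (c * d) * f + const_poly c * g"
      by (simp add: const_poly_mult algebra_simps)
    ultimately show "const_poly c * p \<in> lspan (f # fs)"
      using lspan_ConsI[OF D(3)[of g c]] by metis
  qed
qed (simp add: lin_subspace_def)

lemma set_subset_lspan: "set fs \<subseteq> lspan fs"
proof (induction fs)
  case (Cons f fs)
  have "f \<in> lspan (f # fs)"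
    using lspan_ConsI[OF lin_subspaceD(1)[OF lin_subspace_lspan[of fs]], of 1 f] by simp
  moreover have "g \<in> lspan (f # fs)" if "g \<in> lspan fs" for g
    using lspan_ConsI[OF that, of 0 f] by simp
  ultimately show ?case using Cons by auto
qed simp

lemma keys_lspan: "g \<in> lspan fs \<Longrightarrow> m \<in> Poly_Mapping.keys g \<Longrightarrow> \<exists>f\<in>set fs. m \<in> Poly_Mapping.keys f"
proof (induction fs arbitrary: g)
  case (Cons f fs)
  then obtain c h where g: "g = const_poly c * f + h" "h \<in> lspan fs" by auto
  then have "m \<in> Poly_Mapping.keys f \<or> m \<in> Poly_Mapping.keys h"
    using Cons.prems(2) by (auto simp: in_keys_iff lookup_add)
  then show ?case using Cons.IH[OF g(2)] by auto
qed simp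

lemma carrier_poly_ring:
  "carrier (poly_ring r) = {p. \<forall>m\<in>Poly_Mapping.keys p. Poly_Mapping.keys m \<subseteq> {..<r}}"
  "mult (poly_ring r) = (*)" "one (poly_ring r) = 1" "zero (poly_ring r) = 0" "add (poly_ring r) = (+)"
  by (simp_all add: poly_ring_def)

lemma const_poly_carrier [simp]: "const_poly c \<in> carrier (poly_ring r)"
  by (simp add: carrier_poly_ring const_poly_def)

lemma lin_subspace_carrier: "lin_subspace (carrier (poly_ring r))"
  unfolding lin_subspace_def
proof (intro conjI ballI allI)
  interpret cring "poly_ring r :: 'k::field_char_0 mpoly ring" by (rule cring_poly_ring)
  show "(0 :: 'k mpoly) \<in> carrier (poly_ring r)" using zero_closed by (simp add: carrier_poly_ring)
  show "p + q \<in> carrier (poly_ring r)" if "p \<in> carrier (poly_ring r)" "q \<in> carrier (poly_ring r)" for p q :: "'k mpoly"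
    using a_closed[OF that] by (simp add: carrier_poly_ring(5))
  show "const_poly c * p \<in> carrier (poly_ring r)" if "p \<in> carrier (poly_ring r)" for c and p :: "'k mpoly"
    using m_closed[of "const_poly c" p] that by (simp add: carrier_poly_ring(2))
qed

text \<open>
  The image of this subfield in \<open>R/I\<close> is the field of scalars with respect to which dimensions are taken.
\<close>

lemma subfield_const_poly: "subfield (range const_poly) (poly_ring r :: 'k::field_char_0 mpoly ring)"
proof -
  interpret cring "poly_ring r :: 'k mpoly ring" by (rule cring_poly_ring)
  let ?R = "poly_ring r :: 'k mpoly ring" and ?K = "range const_poly :: 'k mpoly set"
  have neg: "\<ominus>\<^bsub>?R\<^esub> const_poly c = const_poly (- c)" for c
    by (rule minus_equality) (simp_all add: carrier_poly_ring(4,5) const_poly_add[symmetric])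
  have "subring ?K ?R"
  proof (rule subringI)
    show "\<one>\<^bsub>?R\<^esub> \<in> ?K" by (metis carrier_poly_ring(3) const_poly_simps(2) rangeI)
  qed (auto simp: neg carrier_poly_ring(2,5) const_poly_add[symmetric] const_poly_mult[symmetric])
  then have "subcring ?K ?R" by (rule subcringI')
  moreover have "Units (?R\<lparr>carrier := ?K\<rparr>) = ?K - {\<zero>\<^bsub>?R\<^esub>}"
  proof (intro equalityI subsetI)
    fix p assume "p \<in> ?K - {\<zero>\<^bsub>?R\<^esub>}"
    then obtain c where c: "p = const_poly c" "c \<noteq> 0"
      by (auto simp: carrier_poly_ring(4)) (metis const_poly_simps(1))
    then have "p * const_poly (inverse c) = 1" "const_poly (inverse c) * p = 1"
      by (simp_all add: const_poly_mult[symmetric])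
    then show "p \<in> Units (?R\<lparr>carrier := ?K\<rparr>)"
      unfolding Units_def using c by (auto simp: carrier_poly_ring(2,3))
  next
    fix p assume "p \<in> Units (?R\<lparr>carrier := ?K\<rparr>)"
    then show "p \<in> ?K - {\<zero>\<^bsub>?R\<^esub>}" by (auto simp: Units_def carrier_poly_ring(2-4))
  qed
  ultimately show ?thesis by (rule subfieldI)
qed

locale quotient_algebra =
  fixes r :: nat and I :: "'k::field_char_0 mpoly set"
  assumes ideal: "ideal I (poly_ring r)"
begin

abbreviation "R \<equiv> poly_ring r :: 'k mpoly ring"
abbreviation "A \<equiv> quot_alg r I"
abbreviation "q \<equiv> quot_map r I"

sublocale R: cring R by (rule cring_poly_ring)
sublocale I: ideal I R by (rule ideal)
sublocale A: cring A unfolding quot_alg_def by (rule I.quotient_is_cring) (rule cring_poly_ring)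
sublocale q: ring_hom_ring R A q
proof -
  have "quot_map r I = (+>\<^bsub>R\<^esub>) I" by (simp add: quot_map_def fun_eq_iff)
  then show "ring_hom_ring R A q" using I.rcos_ring_hom_ring by (simp add: quot_alg_def)
qed

lemma I_carrier: "I \<subseteq> carrier R"
  using I.Icarr by blast

lemma lin_subspace_I: "lin_subspace I"
  unfolding lin_subspace_def
  using I.zero_closed I.a_closed I.I_l_closed[of _ "const_poly _"]
  by (auto simp: carrier_poly_ring(2,4,5))

lemma q_eq_zero_iff: "p \<in> carrier R \<Longrightarrow> q p = \<zero>\<^bsub>A\<^esub> \<longleftrightarrow> p \<in> I"
proof -
  assume p: "p \<in> carrier R"
  have "\<zero>\<^bsub>A\<^esub> = I" by (simp add: quot_alg_def FactRing_def)
  then show ?thesis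
    using p I.a_rcos_const[of p] I.a_rcos_self[of p] R.abelian_group_axioms I.is_additive_subgroup
    by (metis quot_map_def)
qed

lemma q_add: "p \<in> carrier R \<Longrightarrow> p' \<in> carrier R \<Longrightarrow> q (p + p') = q p \<oplus>\<^bsub>A\<^esub> q p'"
  using q.hom_add by (simp add: carrier_poly_ring(5))

lemma q_mult: "p \<in> carrier R \<Longrightarrow> p' \<in> carrier R \<Longrightarrow> q (p * p') = q p \<otimes>\<^bsub>A\<^esub> q p'"
  using q.hom_mult by (simp add: carrier_poly_ring(2))

lemma q_zero: "q 0 = \<zero>\<^bsub>A\<^esub>"
  using q.hom_zero by (simp add: carrier_poly_ring(4))

lemma q_eq_iff: "p \<in> carrier R \<Longrightarrow> p' \<in> carrier R \<Longrightarrow> q p = q p' \<longleftrightarrow> p - p' \<in> I"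
proof -
  assume p: "p \<in> carrier R" "p' \<in> carrier R"
  have d: "p - p' \<in> carrier R" using p by (intro lin_subspaceD(5)[OF lin_subspace_carrier])
  have "q p = q (p - p') \<oplus>\<^bsub>A\<^esub> q p'" using q_add[OF d p(2)] by simp
  then have "q p = q p' \<longleftrightarrow> q (p - p') = \<zero>\<^bsub>A\<^esub>"
    using d p by (metis A.add.l_cancel_one' q.hom_closed A.a_comm)
  then show ?thesis using q_eq_zero_iff[OF d] by simp
qed

lemma carrier_A: "carrier A = q ` carrier R"
  by (auto simp: quot_alg_def FactRing_def A_RCOSETS_def' quot_map_def)

lemma subfield_base_field: "1 \<notin> I \<Longrightarrow> subfield (base_field r I) A"
  unfolding base_field_def
proof (rule q.img_is_subfield(2)[OF subfield_const_poly])
  assume "1 \<notin> I"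
  then show "\<one>\<^bsub>A\<^esub> \<noteq> \<zero>\<^bsub>A\<^esub>"
    using q_eq_zero_iff[of 1] q.hom_one R.one_closed by (simp add: carrier_poly_ring(3))
qed

lemma Span_q: "set fs \<subseteq> carrier R \<Longrightarrow> A.Span (base_field r I) (map q fs) = q ` lspan fs"
proof (induction fs)
  case (Cons f fs)
  have fs: "lspan fs \<subseteq> carrier R" using Cons.prems by (intro lspan_subset lin_subspace_carrier) auto
  have f: "f \<in> carrier R" using Cons.prems by simp
  have comb: "q (const_poly c * f + g) = q (const_poly c) \<otimes>\<^bsub>A\<^esub> q f \<oplus>\<^bsub>A\<^esub> q g" if "g \<in> lspan fs" for c g
    using that fs f lin_subspaceD(3)[OF lin_subspace_carrier f, of c] by (auto simp: q_add q_mult)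
  have "A.Span (base_field r I) (map q (f # fs))
      = A.line_extension (base_field r I) (q f) (q ` lspan fs)"
    using Cons by simp
  also have "\<dots> = q ` lspan (f # fs)"
    using comb by (auto simp: A.line_extension_mem_iff base_field_def image_iff) metis+
  finally show ?case .
qed (simp add: q_zero)

text \<open>
  Elements with distinct leading monomials, none of which comes from \<open>I\<close>, stay independent modulo \<open>I\<close>.
  Independence of lists is defined by adding elements at the front, so the list is sorted with the
  largest leading monomial first: subtracting from the first element a combination of the others keeps
  its leading monomial, hence the difference is not in \<open>I\<close>.
\<close>

lemma independent_q:
  assumes V: "lin_subspace V" "V \<subseteq> carrier R"
    and "sorted_wrt (\<lambda>f g. lead g < lead f) fs"
    and "\<And>f. f \<in> set fs \<Longrightarrow> f \<in> V \<and> f \<noteq> 0 \<and> lead f \<notin> lead_set (I \<inter> V)"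
  shows "A.independent (base_field r I) (map q fs)"
  using assms(3,4)
proof (induction fs)
  case (Cons f fs)
  have f: "f \<in> V" "f \<noteq> 0" "lead f \<notin> lead_set (I \<inter> V)" and fs: "set fs \<subseteq> V"
    using Cons.prems(2) by auto
  have sub: "lspan fs \<subseteq> V" using fs V by (intro lspan_subset)
  have "q f \<notin> q ` lspan fs"
  proof
    assume "q f \<in> q ` lspan fs"
    then obtain g where g: "g \<in> lspan fs" "q f = q g" by auto
    then have "g \<in> V" using sub by blast
    then have d: "f - g \<in> I \<inter> V" using g(2) f(1) V q_eq_iff[of f g] by (auto intro: lin_subspaceD(5))
    have small: "m < lead f" if m: "m \<in> Poly_Mapping.keys g" for m
    proof -
      obtain h where "h \<in> set fs" "m \<in> Poly_Mapping.keys h" using keys_lspan[OF g(1) m] by blast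
      then show ?thesis using Cons.prems(1) lead_ge[of m h] by (auto intro: le_less_trans)
    qed
    have nk: "lead f \<notin> Poly_Mapping.keys g" using small by blast
    have k: "lead f \<in> Poly_Mapping.keys (f - g)"
      using nk lead_in_keys[OF f(2)] by (simp add: in_keys_iff lookup_minus)
    have "lead (f - g) = lead f"
    proof (rule lead_eqI[OF k])
      fix n assume "n \<in> Poly_Mapping.keys (f - g)"
      then have "n \<in> Poly_Mapping.keys f \<or> n \<in> Poly_Mapping.keys g"
        by (auto simp: in_keys_iff lookup_minus)
      then show "n \<le> lead f" using lead_ge small by (auto intro: less_imp_le)
    qed
    moreover have "f - g \<noteq> 0" using k by auto
    ultimately show False using lead_setI[OF d] f(3) by simp
  qed
  moreover have "A.independent (base_field r I) (map q fs)" using Cons by simp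
  moreover have "q f \<in> carrier A" using f V by auto
  moreover have "set fs \<subseteq> carrier R" using fs V by blast
  ultimately show ?case using Span_q[of fs] by (auto intro: A.li_Cons)
qed simp

text \<open>
  For each leading monomial of \<open>V\<close> that is not one of \<open>I \<inter> V\<close>, choose an element of \<open>V\<close> with this leading
  monomial. The classes of these elements are independent, and they span the image of \<open>V\<close> because
  together with \<open>I \<inter> V\<close> they realize all leading monomials of \<open>V\<close>.
\<close>

theorem dim_k_image:
  assumes "1 \<notin> I" and V: "lin_subspace V" "V \<subseteq> carrier R" and fin: "finite (lead_set V)"
  shows "dim_k r I (q ` V) = card (lead_set V - lead_set (I \<inter> V))"
proof -
  let ?W = "I \<inter> V" and ?K = "base_field r I"
  have W: "lin_subspace ?W" using lin_subspace_I V(1) by (auto simp: lin_subspace_def)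
  define D where "D = lead_set V - lead_set ?W"
  have finD: "finite D" using fin by (simp add: D_def)
  have "\<forall>m\<in>D. \<exists>f. f \<in> V \<and> f \<noteq> 0 \<and> lead f = m" by (auto simp: D_def lead_set_def)
  then obtain f where f: "\<And>m. m \<in> D \<Longrightarrow> f m \<in> V \<and> f m \<noteq> 0 \<and> lead (f m) = m" by metis
  define fs where "fs = map f (rev (sorted_list_of_set D))"
  have set_fs: "set fs = f ` D" using finD by (simp add: fs_def)
  have "sorted_wrt (<) (sorted_list_of_set D)" by (rule strict_sorted_list_of_set)
  then have "sorted_wrt (\<lambda>x y. lead y < lead x) fs"
    unfolding fs_def sorted_wrt_map sorted_wrt_rev
    by (rule sorted_wrt_mono_rel[rotated]) (use f finD in auto)
  then have ind: "A.independent ?K (map q fs)"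
    using f by (intro independent_q[OF V]) (auto simp: set_fs D_def)
  have fsV: "set fs \<subseteq> V" using f set_fs by auto
  \<comment> \<open>The span of the chosen elements and \<open>I \<inter> V\<close>; it has the same leading monomials as \<open>V\<close>.\<close>
  define U where "U = {w + g | w g. w \<in> ?W \<and> g \<in> lspan fs}"
  note S = lin_subspaceD[OF lin_subspace_lspan[of fs]] and D = lin_subspaceD[OF W]
  have inU: "w \<in> U" if "w \<in> ?W" for w
    using that S(1) by (force simp: U_def)
  have inU': "g \<in> U" if "g \<in> lspan fs" for g
    using that D(1) by (force simp: U_def)
  have "lin_subspace U" unfolding lin_subspace_def
  proof (intro conjI ballI allI)
    fix x y assume "x \<in> U" "y \<in> U"
    then obtain w g w' g' where *: "x = w + g" "y = w' + g'" "w \<in> ?W" "w' \<in> ?W" "g \<in> lspan fs" "g' \<in> lspan fs"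
      unfolding U_def by blast
    then have "x + y = (w + w') + (g + g')" by simp
    then show "x + y \<in> U" unfolding U_def using * D(2)[of w w'] S(2)[of g g'] by blast
  next
    fix c x assume "x \<in> U"
    then obtain w g where *: "x = w + g" "w \<in> ?W" "g \<in> lspan fs" unfolding U_def by blast
    then have "const_poly c * x = const_poly c * w + const_poly c * g" by (simp add: distrib_left)
    then show "const_poly c * x \<in> U" unfolding U_def using * D(3)[of w c] S(3)[of g c] by blast
  qed (use inU D(1) in blast)
  moreover have "lspan fs \<subseteq> V" using fsV V by (intro lspan_subset)
  then have "U \<subseteq> V" using lin_subspaceD(2)[OF V(1)] by (auto simp: U_def)
  moreover have "lead_set V \<subseteq> lead_set U"
  proof
    fix m assume m: "m \<in> lead_set V"
    show "m \<in> lead_set U"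
    proof (cases "m \<in> D")
      case True
      then have "f m \<in> U" using set_fs set_subset_lspan[of fs] by (intro inU') auto
      then show ?thesis using f[OF True] lead_setI by fastforce
    next
      case False
      then have "m \<in> lead_set ?W" using m by (simp add: D_def)
      then show ?thesis using lead_set_mono[of ?W U] inU by blast
    qed
  qed
  ultimately have "U = V" using V fin by (intro subspace_eq_if_lead_set_subset)
  have "q ` V = q ` lspan fs"
  proof (intro equalityI subsetI)
    fix x assume "x \<in> q ` V"
    then obtain v where "v \<in> U" "x = q v" using \<open>U = V\<close> by blast
    then obtain w g where *: "x = q (w + g)" "w \<in> ?W" "g \<in> lspan fs"
      unfolding U_def by blast
    have "w \<in> carrier R" "g \<in> carrier R" using * V \<open>lspan fs \<subseteq> V\<close> by auto
    then have "x = q g"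
      unfolding *(1) using * lin_subspaceD(2)[OF lin_subspace_carrier, of w r g] by (subst q_eq_iff) auto
    then show "x \<in> q ` lspan fs" using * by blast
  qed (use \<open>lspan fs \<subseteq> V\<close> in auto)
  also have "\<dots> = A.Span ?K (map q fs)" using fsV V by (subst Span_q) auto
  finally have "A.dimension (length (map q fs)) ?K (q ` V)"
    using A.dimension_independent[OF ind] by simp
  then have "A.dim ?K (q ` V) = length (map q fs)"
    using A.dimI[OF subfield_base_field[OF \<open>1 \<notin> I\<close>]] by (simp add: over_def)
  then show ?thesis by (simp add: dim_k_def fs_def D_def)
qed

end

section \<open>The inequality between h-vector and socle-vector\<close>

definition monomial_space :: "(nat \<Rightarrow>\<^sub>0 nat) set \<Rightarrow> 'k::field_char_0 mpoly set" where
  "monomial_space X = {p. Poly_Mapping.keys p \<subseteq> X}"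

lemma lin_subspace_monomial_space: "lin_subspace (monomial_space X)"
  unfolding lin_subspace_def monomial_space_def
proof (intro conjI ballI allI CollectI)
  show "Poly_Mapping.keys (p + q) \<subseteq> X"
    if "p \<in> {p. Poly_Mapping.keys p \<subseteq> X}" "q \<in> {p. Poly_Mapping.keys p \<subseteq> X}" for p q :: "'a mpoly"
    using that keys_add[of p q] by blast
  show "Poly_Mapping.keys (const_poly c * p) \<subseteq> X"
    if "p \<in> {p. Poly_Mapping.keys p \<subseteq> X}" for c :: 'a and p
    using that by (auto simp: in_keys_iff)
qed simp

lemma lead_set_monomial_space [simp]:
  "lead_set (monomial_space X :: 'k::field_char_0 mpoly set) = X"
proof (intro equalityI subsetI)
  fix m assume m: "m \<in> X"
  let ?p = "Poly_Mapping.single m (1 :: 'k)"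
  have "?p \<in> monomial_space X" using m by (simp add: monomial_space_def)
  moreover have "?p \<noteq> 0" by (metis keys_eq_empty keys_single insert_not_empty zero_neq_one)
  moreover have "lead ?p = m" by (simp add: lead_def)
  ultimately show "m \<in> lead_set (monomial_space X :: 'k mpoly set)" using lead_setI by metis
next
  fix m assume "m \<in> lead_set (monomial_space X :: 'k mpoly set)"
  then obtain p :: "'k mpoly" where "Poly_Mapping.keys p \<subseteq> X" "p \<noteq> 0" "m = lead p"
    by (auto simp: lead_set_def monomial_space_def)
  then show "m \<in> X" using lead_in_keys by blast
qed

lemma forms_eq: "forms r d = monomial_space (monomials d r)"
  by (auto simp: forms_def carrier_poly_ring monomial_space_def monomials_def)

lemma forms_carrier: "forms r d \<subseteq> carrier (poly_ring r)"
  by (auto simp: forms_def)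

lemma lin_subspace_forms: "lin_subspace (forms r d)"
  by (simp add: forms_eq lin_subspace_monomial_space)

lemma lin_subspace_Int: "lin_subspace U \<Longrightarrow> lin_subspace V \<Longrightarrow> lin_subspace (U \<inter> V)"
  by (auto simp: lin_subspace_def)

lemma var_poly_carrier: "i < r \<Longrightarrow> var_poly i \<in> carrier (poly_ring r)"
  by (simp add: carrier_poly_ring var_poly_def)

lemma var_poly_mult_forms: "i < r \<Longrightarrow> f \<in> forms r d \<Longrightarrow> var_poly i * f \<in> forms r (Suc d)"
proof -
  assume i: "i < r" and "f \<in> forms r d"
  then have "Poly_Mapping.keys f \<subseteq> monomials d r" by (simp add: forms_eq monomial_space_def)
  moreover have "m + mvar i \<in> monomials (Suc d) r" if "m \<in> monomials d r" for m
    using that i by (simp add: monomials_def mono_deg_add keys_add_mono)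
  ultimately show ?thesis by (auto simp: forms_eq monomial_space_def keys_var_poly_mult)
qed

lemma forms_0: "f \<in> forms r 0 \<Longrightarrow> \<exists>c. f = const_poly c"
proof
  assume "f \<in> forms r 0"
  then have "Poly_Mapping.keys f \<subseteq> {0}" by (simp add: forms_eq monomial_space_def)
  then show "f = const_poly (Poly_Mapping.lookup f 0)"
    by (intro poly_mapping_eqI) (auto simp: const_poly_def lookup_single when_def in_keys_iff)
qed

context quotient_algebra
begin

text \<open>
  The monomials whose classes form the usual basis of the graded piece of degree \<open>d\<close>.
\<close>

definition standard_monomials :: "nat \<Rightarrow> (nat \<Rightarrow>\<^sub>0 nat) set" where
  "standard_monomials d = monomials d r - lead_set (I \<inter> forms r d)"

text \<open>
  The preimage in degree \<open>d\<close> of the socle: the forms of degree \<open>d\<close> in the ideal quotient of \<open>I\<close> by the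
  variables.
\<close>

definition socle_forms :: "nat \<Rightarrow> 'k mpoly set" where
  "socle_forms d = {f \<in> forms r d. \<forall>i<r. var_poly i * f \<in> I}"

lemma lin_subspace_socle_forms: "lin_subspace (socle_forms d)"
proof -
  note F = lin_subspaceD[OF lin_subspace_forms[of r d]] and D = lin_subspaceD[OF lin_subspace_I]
  show ?thesis unfolding lin_subspace_def
  proof (intro conjI ballI allI)
    show "0 \<in> socle_forms d" using F(1) D(1) by (simp add: socle_forms_def)
    show "f + g \<in> socle_forms d" if "f \<in> socle_forms d" "g \<in> socle_forms d" for f g
      using that F(2)[of f g] D(2) by (simp add: socle_forms_def distrib_left)
    show "const_poly c * f \<in> socle_forms d" if "f \<in> socle_forms d" for c f
    proof -
      have "var_poly i * (const_poly c * f) \<in> I" if "i < r" for i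
        using D(3)[of "var_poly i * f" c] that \<open>f \<in> socle_forms d\<close>
        by (simp add: socle_forms_def mult.left_commute)
      then show ?thesis using F(3)[of f c] that by (simp add: socle_forms_def)
    qed
  qed
qed

lemma I_forms_subset_socle_forms: "I \<inter> forms r d \<subseteq> socle_forms d"
proof
  fix f assume f: "f \<in> I \<inter> forms r d"
  have "var_poly i * f \<in> I" if "i < r" for i
    using I.I_l_closed[of f "var_poly i"] f var_poly_carrier[OF that] by (simp add: carrier_poly_ring(2))
  then show "f \<in> socle_forms d" using f by (simp add: socle_forms_def)
qed

text \<open>
  The annihilator of an element is an ideal, so an element is annihilated by the maximal ideal as soon
  as it is annihilated by the classes of the variables.
\<close>

lemma socle_Int_graded_piece: "socle r I \<inter> graded_piece r I d = q ` socle_forms d"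
proof (intro equalityI subsetI)
  fix a assume a: "a \<in> socle r I \<inter> graded_piece r I d"
  then obtain f where f: "f \<in> forms r d" "a = q f" by (auto simp: graded_piece_def)
  have fc: "f \<in> carrier R" using f forms_carrier by blast
  have "var_poly i * f \<in> I" if i: "i < r" for i
  proof -
    have "q ` var_poly ` {..<r} \<subseteq> carrier A"
      using var_poly_carrier q.hom_closed by blast
    then have "q (var_poly i) \<in> max_ideal r I"
      unfolding max_ideal_def using A.genideal_self[of "(\<lambda>i. q (var_poly i)) ` {..<r}"] i
      by (auto simp: image_image)
    then have "q f \<otimes>\<^bsub>A\<^esub> q (var_poly i) = \<zero>\<^bsub>A\<^esub>" using a f by (auto simp: socle_def)
    then have "q (f * var_poly i) = \<zero>\<^bsub>A\<^esub>" using q_mult[OF fc var_poly_carrier[OF i]] by simp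
    moreover have "f * var_poly i \<in> carrier R"
      using R.m_closed[OF fc var_poly_carrier[OF i]] by (simp add: carrier_poly_ring(2))
    ultimately show ?thesis using q_eq_zero_iff by (simp add: mult.commute)
  qed
  then show "a \<in> q ` socle_forms d" using f by (auto simp: socle_forms_def)
next
  fix a assume "a \<in> q ` socle_forms d"
  then obtain f where f: "f \<in> forms r d" "a = q f" "\<And>i. i < r \<Longrightarrow> var_poly i * f \<in> I"
    by (auto simp: socle_forms_def)
  have fc: "f \<in> carrier R" using f forms_carrier by blast
  then have ac: "a \<in> carrier A" using f by simp
  define N where "N = {b \<in> carrier A. a \<otimes>\<^bsub>A\<^esub> b = \<zero>\<^bsub>A\<^esub>}"
  have "ideal N A"
  proof (rule idealI)
    show "subgroup N (add_monoid A)"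
      by (rule A.add.subgroupI) (use ac in \<open>auto simp: N_def A.r_distr A.r_minus a_inv_def[symmetric]\<close>)
  next
    fix b x assume "b \<in> N" "x \<in> carrier A"
    then show "x \<otimes>\<^bsub>A\<^esub> b \<in> N" using ac A.m_lcomm[of a x b] by (simp add: N_def)
    then show "b \<otimes>\<^bsub>A\<^esub> x \<in> N" using \<open>b \<in> N\<close> \<open>x \<in> carrier A\<close> by (simp add: N_def A.m_comm)
  qed (rule A.ring_axioms)
  moreover have "(\<lambda>i. q (var_poly i)) ` {..<r} \<subseteq> N"
  proof safe
    fix i assume i: "i < r"
    have vc: "var_poly i \<in> carrier R" by (rule var_poly_carrier[OF i])
    have "a \<otimes>\<^bsub>A\<^esub> q (var_poly i) = q (var_poly i * f)"
      using q_mult[OF vc fc] A.m_comm[OF ac q.hom_closed[OF vc]] f(2) by simp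
    also have "\<dots> = \<zero>\<^bsub>A\<^esub>" using f(3)[OF i] I_carrier q_eq_zero_iff by blast
    finally show "q (var_poly i) \<in> N" using vc by (simp add: N_def)
  qed
  ultimately have "max_ideal r I \<subseteq> N" unfolding max_ideal_def by (rule A.genideal_minimal)
  then show "a \<in> socle r I \<inter> graded_piece r I d"
    using f ac by (auto simp: socle_def N_def graded_piece_def)
qed

lemma lead_set_socle_forms_subset: "lead_set (socle_forms d) \<subseteq> monomials d r"
  using lead_set_mono[of "socle_forms d" "forms r d"] by (auto simp: socle_forms_def forms_eq)

lemma dim_graded_piece: "1 \<notin> I \<Longrightarrow> dim_k r I (graded_piece r I d) = card (standard_monomials d)"
  unfolding graded_piece_def standard_monomials_def
  by (subst dim_k_image) (simp_all add: lin_subspace_forms forms_carrier, simp_all add: forms_eq)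

lemma dim_socle_piece:
  assumes "1 \<notin> I"
  shows "dim_k r I (socle r I \<inter> graded_piece r I d)
    = card (lead_set (socle_forms d) - lead_set (I \<inter> forms r d))"
proof -
  have "I \<inter> socle_forms d = I \<inter> forms r d"
    using I_forms_subset_socle_forms by (auto simp: socle_forms_def)
  moreover have "finite (lead_set (socle_forms d))"
    using lead_set_socle_forms_subset finite_monomials by (rule finite_subset)
  moreover have "socle_forms d \<subseteq> carrier R" using forms_carrier by (auto simp: socle_forms_def)
  ultimately show ?thesis
    unfolding socle_Int_graded_piece using assms lin_subspace_socle_forms by (subst dim_k_image) auto
qed

text \<open>
  If \<open>m\<close> is the leading monomial of a form \<open>f\<close> with \<open>x\<^sub>i f \<in> I\<close> for all \<open>i\<close>, then \<open>x\<^sub>i m\<close> is a leading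
  monomial of \<open>I\<close>, so \<open>m\<close> is not in the shadow of the standard monomials of degree \<open>Suc d\<close>. The shadow
  and the leading monomials that count the socle are therefore disjoint sets of standard monomials.
\<close>

theorem min_shadow_add_socle_le:
  assumes "1 \<notin> I"
  shows "min_shadow (Suc d) (dim_k r I (graded_piece r I (Suc d)))
      + dim_k r I (socle r I \<inter> graded_piece r I d) \<le> dim_k r I (graded_piece r I d)"
proof -
  let ?S = "lead_set (socle_forms d) - lead_set (I \<inter> forms r d)"
  have disj: "m \<notin> lead_set (socle_forms d)" if m: "m \<in> shadow (standard_monomials (Suc d))" for m
  proof
    assume "m \<in> lead_set (socle_forms d)"
    then obtain f where f: "f \<in> socle_forms d" "f \<noteq> 0" "m = lead f" by (auto simp: lead_set_def)
    obtain i where i: "m + mvar i \<in> standard_monomials (Suc d)" using m by (auto simp: shadow_def)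
    then have "i < r" by (auto simp: standard_monomials_def monomials_def keys_add_mono)
    then have "var_poly i * f \<in> I \<inter> forms r (Suc d)"
      using f var_poly_mult_forms by (auto simp: socle_forms_def)
    then have "lead (var_poly i * f) \<in> lead_set (I \<inter> forms r (Suc d))"
      using f by (intro lead_setI) auto
    then show False using i f by (simp add: lead_var_poly_mult standard_monomials_def)
  qed
  have "shadow (standard_monomials (Suc d)) \<subseteq> monomials d r"
    by (auto simp: shadow_def standard_monomials_def monomials_def mono_deg_add keys_add_mono)
  moreover have "lead_set (I \<inter> forms r d) \<subseteq> lead_set (socle_forms d)"
    by (intro lead_set_mono I_forms_subset_socle_forms)
  ultimately have sub: "shadow (standard_monomials (Suc d)) \<union> ?S \<subseteq> standard_monomials d"
    using disj lead_set_socle_forms_subset[of d] unfolding standard_monomials_def[of d] by blast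
  have fin: "finite (standard_monomials d)" for d by (simp add: standard_monomials_def)
  have "min_shadow (Suc d) (card (standard_monomials (Suc d))) \<le> card (shadow (standard_monomials (Suc d)))"
    using fin by (intro min_shadow_le_card_shadow) (auto simp: standard_monomials_def monomials_def)
  moreover have "card (shadow (standard_monomials (Suc d))) + card ?S = card (shadow (standard_monomials (Suc d)) \<union> ?S)"
    using disj sub finite_subset[OF _ fin] by (intro card_Un_disjoint[symmetric]) auto
  moreover have "\<dots> \<le> card (standard_monomials d)" using sub fin by (intro card_mono)
  ultimately show ?thesis using assms by (simp add: dim_graded_piece dim_socle_piece)
qed

end

lemma h_vec_nth: "i \<le> e \<Longrightarrow> h_vec r I e ! i = dim_k r I (graded_piece r I i)"
  by (simp add: h_vec_def del: upt_Suc)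

lemma socle_vec_nth: "i \<le> e \<Longrightarrow> socle_vec r I e ! i = dim_k r I (socle r I \<inter> graded_piece r I i)"
  by (simp add: socle_vec_def del: upt_Suc)

lemma length_h_vec [simp]: "length (h_vec r I e) = Suc e"
  by (simp add: h_vec_def)

lemma length_socle_vec [simp]: "length (socle_vec r I e) = Suc e"
  by (simp add: socle_vec_def)

text \<open>
  Besides the main inequality, this records the values at both ends. The codimension is \<open>h\<^sub>1\<close> because
  \<open>I\<close> has no linear forms; a nonzero scalar is not in the socle for the same reason; and the whole top
  degree is in the socle because the next degree vanishes.
\<close>

theorem graded_artinian_alg_necessary:
  fixes I :: "'k::field_char_0 mpoly set"
  assumes "graded_artinian_alg r I e"
  defines "h \<equiv> h_vec r I e" and "s \<equiv> socle_vec r I e"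
  shows "1 \<le> e" "h ! 0 = 1" "h ! 1 = r" "0 < h ! e" "s ! 0 = 0" "s ! e = h ! e"
    "\<And>i. i < e \<Longrightarrow> min_shadow (Suc i) (h ! Suc i) + s ! i \<le> h ! i"
proof -
  interpret quotient_algebra r I
    using assms(1) by (intro quotient_algebra.intro) (simp add: graded_artinian_alg_def homogeneous_ideal_def)
  have lin: "I \<inter> forms r 1 = {0}" and e: "1 \<le> e"
    and top: "graded_piece r I e \<noteq> {\<zero>\<^bsub>A\<^esub>}"
    and above: "\<And>i. i > e \<Longrightarrow> graded_piece r I i = {\<zero>\<^bsub>A\<^esub>}"
    using assms(1) by (auto simp: graded_artinian_alg_def)
  have in_I: "f \<in> I \<longleftrightarrow> q f = \<zero>\<^bsub>A\<^esub>" if "f \<in> forms r d" for f d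
    using that forms_carrier q_eq_zero_iff by blast
  have "\<zero>\<^bsub>A\<^esub> \<in> graded_piece r I e"
    unfolding graded_piece_def using lin_subspaceD(1)[OF lin_subspace_forms] q_zero by (metis image_eqI)
  then obtain f where f: "f \<in> forms r e" "f \<notin> I"
    using top in_I by (fastforce simp: graded_piece_def)
  have unit: "1 \<notin> I"
    using f I.I_l_closed[of 1 f] forms_carrier[of r e] by (auto simp: carrier_poly_ring(2))
  have zero_I: "0 \<in> I" by (rule lin_subspaceD(1)[OF lin_subspace_I])
  have const: "const_poly c \<in> I \<longleftrightarrow> c = 0" for c
    using unit zero_I lin_subspaceD(3)[OF lin_subspace_I, of "const_poly c" "inverse c"]
    by (cases "c = 0") (auto simp: const_poly_mult[symmetric])
  have r: "r > 0"
  proof (rule ccontr)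
    assume "\<not> r > 0"
    then have "(forms r e :: 'k mpoly set) = {0}" using e by (cases e) (auto simp: forms_eq monomial_space_def)
    then show False using f zero_I by auto
  qed
  have h: "h ! i = card (standard_monomials i)" if "i \<le> e" for i
    using that unit by (simp add: h_def h_vec_nth dim_graded_piece)
  have s: "s ! i = card (lead_set (socle_forms i) - lead_set (I \<inter> forms r i))" if "i \<le> e" for i
    using that unit by (simp add: s_def socle_vec_nth dim_socle_piece)
  have lead_0: "lead_set {0} = {}" by (simp add: lead_set_def)
  show "1 \<le> e" by (rule e)
  show "h ! 1 = r"
    using h[OF e] lin card_monomials[of 1 r] by (simp add: standard_monomials_def lead_0)
  have "f = 0" if "f \<in> I \<inter> forms r 0" for f
    using that const forms_0[of f r] by auto
  then have "lead_set (I \<inter> forms r 0) = {}" by (auto simp: lead_set_def)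
  then show "h ! 0 = 1" using h[of 0] by (simp add: standard_monomials_def)
  have "f = 0" if "f \<in> socle_forms 0" for f
  proof -
    have "var_poly 0 * f \<in> I \<inter> forms r 1"
      using that r var_poly_mult_forms[of 0 r f 0] by (auto simp: socle_forms_def)
    then have "var_poly 0 * f = 0" using lin by blast
    then show "f = 0" by simp
  qed
  then have "lead_set (socle_forms 0) = {}" by (auto simp: lead_set_def)
  then show "s ! 0 = 0" using s[of 0] by simp
  have "forms r (Suc e) \<subseteq> I" using above[of "Suc e"] in_I by (auto simp: graded_piece_def)
  then have "socle_forms e = forms r e" using var_poly_mult_forms by (fastforce simp: socle_forms_def)
  then have "lead_set (socle_forms e) = monomials e r" by (simp add: forms_eq)
  then show "s ! e = h ! e" using s[of e] h[of e] by (simp add: standard_monomials_def)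
  have "standard_monomials e \<noteq> {}"
  proof
    assume "standard_monomials e = {}"
    then have "lead_set (forms r e :: 'k mpoly set) \<subseteq> lead_set (I \<inter> forms r e)"
      by (simp add: standard_monomials_def forms_eq)
    then have "I \<inter> forms r e = forms r e"
      by (intro subspace_eq_if_lead_set_subset lin_subspace_Int lin_subspace_I lin_subspace_forms)
         (auto simp: forms_eq)
    then show False using f by auto
  qed
  then show "0 < h ! e" using h[of e] by (simp add: card_gt_0_iff standard_monomials_def)
  show "min_shadow (Suc i) (h ! Suc i) + s ! i \<le> h ! i" if "i < e" for i
    using that min_shadow_add_socle_le[OF unit, of i] by (simp add: h_def s_def h_vec_nth socle_vec_nth)
qed

section \<open>Monomial algebras\<close>

definition restrict_poly :: "((nat \<Rightarrow>\<^sub>0 nat) \<Rightarrow> bool) \<Rightarrow> 'k::field_char_0 mpoly \<Rightarrow> 'k mpoly" where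
  "restrict_poly P p =
    (\<Sum>m | m \<in> Poly_Mapping.keys p \<and> P m. Poly_Mapping.single m (Poly_Mapping.lookup p m))"

lemma lookup_restrict_poly:
  "Poly_Mapping.lookup (restrict_poly P p) x = (if P x then Poly_Mapping.lookup p x else 0)"
proof -
  have "Poly_Mapping.lookup (restrict_poly P p) x =
    (\<Sum>m | m \<in> Poly_Mapping.keys p \<and> P m. if m = x then Poly_Mapping.lookup p x else 0)"
    unfolding restrict_poly_def lookup_sum
    by (intro sum.cong) (auto simp: lookup_single when_def)
  also have "\<dots> = (if P x then Poly_Mapping.lookup p x else 0)"
    by (auto simp: sum.delta in_keys_iff)
  finally show ?thesis .
qed

lemma keys_restrict_poly: "Poly_Mapping.keys (restrict_poly P p) = {m \<in> Poly_Mapping.keys p. P m}"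
  by (auto simp: in_keys_iff lookup_restrict_poly split: if_splits)

lemma hom_component_eq: "hom_component d p = restrict_poly (\<lambda>m. mono_deg m = d) p"
  by (simp add: hom_component_def restrict_poly_def)

lemma decreasing_finite_sets_stabilize:
  assumes "finite (X 0)" "\<And>n. X (Suc n) \<subseteq> X n"
  shows "\<exists>N. \<forall>n\<ge>N. X n = X N"
proof -
  have anti: "X n \<subseteq> X m" if "m \<le> n" for m n :: nat
    using lift_Suc_antimono_le[of X m n] assms(2) that by blast
  then have fin: "finite (X n)" for n
    using finite_subset[OF _ assms(1)] by blast
  define N where "N = (ARG_MIN (\<lambda>n. card (X n)) n. True)"
  have "card (X N) \<le> card (X n)" for n
    unfolding N_def by (rule arg_min_nat_le) simp
  then have "X n = X N" if "n \<ge> N" for n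
    using anti[OF that] fin by (intro card_seteq) auto
  then show ?thesis by blast
qed

text \<open>
  If finitely many monomials span \<open>R/I\<close>, an ideal of \<open>R/I\<close> is determined by its preimage in the span of
  these monomials. In a descending chain the finite sets of leading monomials of the preimages
  stabilize, hence so do the preimages, by \<open>subspace_eq_if_lead_set_subset\<close>.
\<close>

lemma (in quotient_algebra) artinian_if_finite_complement:
  assumes "finite X" and "monomial_space X \<subseteq> carrier R"
    and span: "\<And>p. p \<in> carrier R \<Longrightarrow> \<exists>p'\<in>monomial_space X. p - p' \<in> I"
  shows "artinian_ring A"
  unfolding artinian_ring_def
proof (intro conjI allI impI)
  fix J :: "nat \<Rightarrow> 'k mpoly set set"
  assume "(\<forall>n. ideal (J n) A) \<and> (\<forall>n. J (Suc n) \<subseteq> J n)"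
  then have J: "\<And>n. ideal (J n) A" and dec: "\<And>n. J (Suc n) \<subseteq> J n" by auto
  define P where "P n = {p \<in> monomial_space X. q p \<in> J n}" for n
  have carr: "p \<in> carrier R" if "p \<in> P n" for p n using that assms(2) by (auto simp: P_def)
  note M = lin_subspaceD[OF lin_subspace_monomial_space[of X]]
  have P: "lin_subspace (P n)" for n
  proof -
    interpret J: ideal "J n" A by (rule J)
    show ?thesis unfolding lin_subspace_def
    proof (intro conjI ballI allI)
      show "0 \<in> P n" using M(1) J.zero_closed by (simp add: P_def q_zero)
      show "f + g \<in> P n" if "f \<in> P n" "g \<in> P n" for f g
        using that M(2)[of f g] J.a_closed[of "q f" "q g"] carr[OF that(1)] carr[OF that(2)]
        by (simp add: P_def q_add)
      show "const_poly c * f \<in> P n" if "f \<in> P n" for c f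
        using that M(3)[of f c] J.I_l_closed[of "q f" "q (const_poly c)"] carr[OF that]
        by (simp add: P_def q_mult)
    qed
  qed
  have sub: "lead_set (P n) \<subseteq> X" for n
    using lead_set_mono[of "P n" "monomial_space X"] by (auto simp: P_def)
  have "\<exists>N. \<forall>n\<ge>N. lead_set (P n) = lead_set (P N)"
    using dec finite_subset[OF sub \<open>finite X\<close>]
    by (intro decreasing_finite_sets_stabilize lead_set_mono) (auto simp: P_def)
  then obtain N where N: "\<And>n. n \<ge> N \<Longrightarrow> lead_set (P n) = lead_set (P N)" by blast
  have "J n = J N" if "n \<ge> N" for n
  proof
    show "J n \<subseteq> J N" using lift_Suc_antimono_le[of J N n] dec that by blast
    then have "P n = P N"
      using N[OF that] P finite_subset[OF sub \<open>finite X\<close>]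
      by (intro subspace_eq_if_lead_set_subset) (auto simp: P_def)
    show "J N \<subseteq> J n"
    proof
      fix a assume a: "a \<in> J N"
      then have "a \<in> carrier A" using ideal.Icarr[OF J] by blast
      then obtain p where p: "p \<in> carrier R" "a = q p" unfolding carrier_A by blast
      then obtain p' where p': "p' \<in> monomial_space X" "p - p' \<in> I" using span by blast
      then have "a = q p'" using p q_eq_iff[of p p'] assms(2) by blast
      then have "p' \<in> P n" using a p' \<open>P n = P N\<close> by (simp add: P_def)
      then show "a \<in> J n" using \<open>a = q p'\<close> by (simp add: P_def)
    qed
  qed
  then show "\<exists>N. \<forall>n\<ge>N. J n = J N" by blast
qed (rule A.ring_axioms)

text \<open>
  The monomials outside a finite set that is closed under division span a monomial ideal. Both \<open>I\<close> and
  the forms that represent the socle are spanned by monomials in each degree, so all dimensions are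
  numbers of monomials: the socle is spanned by those elements of \<open>N d\<close> that do not divide an
  element of \<open>N (Suc d)\<close>.
\<close>

theorem monomial_algebra:
  fixes N :: "nat \<Rightarrow> (nat \<Rightarrow>\<^sub>0 nat) set"
  assumes sub: "\<And>d. N d \<subseteq> monomials d r" and sh: "\<And>d. shadow (N (Suc d)) \<subseteq> N d"
    and N1: "N 1 = monomials 1 r" and e: "1 \<le> e" and Ne: "N e \<noteq> {}"
    and above: "\<And>d. d > e \<Longrightarrow> N d = {}"
  defines "I \<equiv> {p \<in> carrier (poly_ring r). Poly_Mapping.keys p \<inter> (\<Union>d. N d) = {}}"
  shows "graded_artinian_alg r (I :: 'k::field_char_0 mpoly set) e"
    and "\<And>d. dim_k r I (graded_piece r I d) = card (N d)"
    and "\<And>d. dim_k r I (socle r I \<inter> graded_piece r I d) = card (N d - shadow (N (Suc d)))"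
proof -
  let ?S = "\<Union>d. N d" and ?R = "poly_ring r :: 'k mpoly ring"
  have inS: "m \<in> ?S \<longleftrightarrow> m \<in> N (mono_deg m)" for m
    using sub by (fastforce simp: monomials_def)
  \<comment> \<open>Closure under division by one variable implies closure under arbitrary division.\<close>
  have down: "b \<in> ?S" if "a + b \<in> ?S" for a b
    using that
  proof (induction "mono_deg a" arbitrary: a)
    case (Suc n)
    then have "a \<noteq> 0" by auto
    then obtain i where i: "i \<in> Poly_Mapping.keys a" by (metis all_not_in_conv keys_eq_empty)
    define a' where "a' = a - mvar i"
    have a: "a = a' + mvar i" using minus_mvar_add[OF i] by (simp add: a'_def)
    have "n = mono_deg a'" using Suc.hyps(2) by (simp add: a mono_deg_add)
    moreover have "a' + b + mvar i \<in> N (Suc (mono_deg (a' + b)))"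
      using Suc.prems inS[of "a + b"] by (simp add: a mono_deg_add ac_simps)
    then have "a' + b \<in> shadow (N (Suc (mono_deg (a' + b))))" by (auto simp: shadow_def)
    then have "a' + b \<in> ?S" using sh by blast
    ultimately show ?case by (rule Suc.hyps(1))
  qed simp
  have I_eq: "I = monomial_space ({m. Poly_Mapping.keys m \<subseteq> {..<r}} - ?S)"
    by (auto simp: I_def monomial_space_def carrier_poly_ring)
  have "lin_subspace I" unfolding I_eq by (rule lin_subspace_monomial_space)
  note L = lin_subspaceD[OF this]
  interpret R: cring ?R by (rule cring_poly_ring)
  have ideal: "ideal I ?R"
  proof (rule idealI)
    have neg: "\<ominus>\<^bsub>?R\<^esub> p = - p" if "p \<in> I" for p
      by (rule R.minus_equality) (use that L(4)[OF that] in \<open>auto simp: carrier_poly_ring(4,5) I_def\<close>)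
    show "subgroup I (add_monoid ?R)"
      using L(1,2,4) neg
      by (intro R.add.subgroupI) (auto simp: carrier_poly_ring(5) a_inv_def[symmetric], auto simp: I_def)
  next
    fix p x assume p: "p \<in> I" and x: "x \<in> carrier ?R"
    have pc: "p \<in> carrier ?R" using p by (simp add: I_def)
    have "m \<notin> ?S" if m: "m \<in> Poly_Mapping.keys (x * p)" for m
    proof
      assume "m \<in> ?S"
      obtain a b where "b \<in> Poly_Mapping.keys p" "m = a + b" using m keys_mult[of x p] by blast
      then show False using down[of a b] \<open>m \<in> ?S\<close> p by (auto simp: I_def)
    qed
    then show "x \<otimes>\<^bsub>?R\<^esub> p \<in> I"
      using R.m_closed[OF x pc] by (auto simp: I_def carrier_poly_ring(2))
    then show "p \<otimes>\<^bsub>?R\<^esub> x \<in> I" using R.m_comm[OF x pc] by simp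
  qed (rule R.ring_axioms)
  interpret quotient_algebra r I by (rule quotient_algebra.intro[OF ideal])
  have forms: "I \<inter> forms r d = monomial_space (monomials d r - N d)" for d
  proof -
    have "m \<in> ?S \<longleftrightarrow> m \<in> N d" if "m \<in> monomials d r" for m
      using that inS[of m] by (simp add: monomials_def)
    then show ?thesis
      unfolding I_eq forms_eq monomial_space_def by (auto simp: monomials_def)
  qed
  have socle: "socle_forms d = monomial_space (monomials d r - shadow (N (Suc d)))" for d
  proof -
    have "(\<forall>i<r. var_poly i * f \<in> I) \<longleftrightarrow> Poly_Mapping.keys f \<inter> shadow (N (Suc d)) = {}"
      if f: "f \<in> forms r d" for f
    proof -
      have "var_poly i * f \<in> I \<longleftrightarrow> (\<forall>m\<in>Poly_Mapping.keys f. m + mvar i \<notin> N (Suc d))" if "i < r" for i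
      proof -
        have "var_poly i * f \<in> I \<longleftrightarrow> var_poly i * f \<in> I \<inter> forms r (Suc d)"
          using var_poly_mult_forms[OF that f] by simp
        also have "\<dots> \<longleftrightarrow> (\<forall>m\<in>Poly_Mapping.keys f. m + mvar i \<notin> N (Suc d))"
          using var_poly_mult_forms[OF that f] unfolding forms
          by (auto simp: forms_eq monomial_space_def keys_var_poly_mult)
        finally show ?thesis .
      qed
      moreover have "i < r" if "m + mvar i \<in> N (Suc d)" for i m
        using that sub[of "Suc d"] by (auto simp: monomials_def keys_add_mono)
      ultimately have "(\<forall>i<r. var_poly i * f \<in> I) \<longleftrightarrow> (\<forall>i. \<forall>m\<in>Poly_Mapping.keys f. m + mvar i \<notin> N (Suc d))"
        by metis
      then show ?thesis unfolding shadow_def by blast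
    qed
    then show ?thesis by (auto simp: socle_forms_def forms_eq monomial_space_def)
  qed
  have fc: "f \<in> I \<longleftrightarrow> q f = \<zero>\<^bsub>A\<^esub>" if "f \<in> forms r d" for f d
    using that forms_carrier q_eq_zero_iff by blast
  have piece: "graded_piece r I d = {\<zero>\<^bsub>A\<^esub>} \<longleftrightarrow> N d = {}" for d
  proof
    assume *: "graded_piece r I d = {\<zero>\<^bsub>A\<^esub>}"
    then have "I \<inter> forms r d = forms r d" using fc by (auto simp: graded_piece_def)
    then have "lead_set (I \<inter> forms r d) = lead_set (forms r d :: 'k mpoly set)" by (rule arg_cong)
    then show "N d = {}" using sub by (auto simp: forms, auto simp: forms_eq)
  next
    assume "N d = {}"
    then have "forms r d \<subseteq> I" using forms[of d] by (auto simp: forms_eq)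
    then have "graded_piece r I d \<subseteq> {\<zero>\<^bsub>A\<^esub>}" using fc by (auto simp: graded_piece_def)
    moreover have "\<zero>\<^bsub>A\<^esub> \<in> graded_piece r I d"
      unfolding graded_piece_def q_zero[symmetric] using lin_subspaceD(1)[OF lin_subspace_forms] by blast
    ultimately show "graded_piece r I d = {\<zero>\<^bsub>A\<^esub>}" by blast
  qed
  have art: "artinian_ring A"
  proof (rule artinian_if_finite_complement)
    have "?S = (\<Union>d\<le>e. N d)" using above by (force simp: not_le[symmetric])
    then show "finite ?S" using finite_subset[OF sub finite_monomials] by simp
    show "monomial_space ?S \<subseteq> carrier R"
      using sub by (fastforce simp: monomial_space_def carrier_poly_ring monomials_def)
    fix p assume "p \<in> carrier R"
    then have "p - restrict_poly (\<lambda>m. m \<in> ?S) p \<in> I"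
      by (auto simp: I_def carrier_poly_ring in_keys_iff lookup_minus lookup_restrict_poly split: if_splits)
    moreover have "restrict_poly (\<lambda>m. m \<in> ?S) p \<in> monomial_space ?S"
      by (auto simp: monomial_space_def keys_restrict_poly)
    ultimately show "\<exists>p'\<in>monomial_space ?S. p - p' \<in> I" by blast
  qed
  have hom: "homogeneous_ideal r I"
    using ideal by (auto simp: homogeneous_ideal_def hom_component_eq I_def carrier_poly_ring keys_restrict_poly)
  have lin: "I \<inter> forms r 1 = {0}"
    unfolding forms N1 by (auto simp: monomial_space_def)
  show "graded_artinian_alg r I e"
    unfolding graded_artinian_alg_def
  proof (intro conjI allI impI)
    show "graded_piece r I e \<noteq> {\<zero>\<^bsub>A\<^esub>}" unfolding piece by (rule Ne)
    show "graded_piece r I i = {\<zero>\<^bsub>A\<^esub>}" if "i > e" for i unfolding piece by (rule above[OF that])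
  qed (fact hom lin art e)+
  have "1 \<notin> I"
  proof
    obtain m where "m \<in> N e" using Ne by blast
    then have "m + 0 \<in> ?S" by auto
    then have "0 \<in> ?S" by (rule down)
    assume "1 \<in> I"
    then have "Poly_Mapping.keys (1 :: 'k mpoly) \<inter> ?S = {}" unfolding I_def by blast
    then show False using \<open>0 \<in> ?S\<close> unfolding keys_one by blast
  qed
  then show "dim_k r I (graded_piece r I d) = card (N d)" for d
    using sub[of d] by (simp add: dim_graded_piece standard_monomials_def forms double_diff)
  show "dim_k r I (socle r I \<inter> graded_piece r I d) = card (N d - shadow (N (Suc d)))" for d
  proof -
    have "monomials d r - shadow (N (Suc d)) - (monomials d r - N d) = N d - shadow (N (Suc d))"
      using sub[of d] by blast
    then show ?thesis using \<open>1 \<notin> I\<close> by (simp add: dim_socle_piece forms socle)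
  qed
qed

section \<open>Extremal pairs of vectors\<close>

text \<open>
  An initial segment of degree at least two that is too large for \<open>a\<close> variables contains the first
  monomial of block \<open>a\<close>, and so its shadow is too large for \<open>a\<close> variables as well.
\<close>

lemma le_mono_count_if_min_shadow_le:
  assumes "min_shadow (Suc (Suc d)) n \<le> mono_count (Suc d) a"
  shows "n \<le> mono_count (Suc (Suc d)) a"
proof (rule ccontr)
  let ?L = "mono_count (Suc (Suc d)) a"
  assume "\<not> n \<le> ?L"
  then have "min_shadow (Suc (Suc d)) (?L + 1) \<le> min_shadow (Suc (Suc d)) n"
    by (intro min_shadow_mono) simp
  moreover have "min_shadow (Suc (Suc d)) (?L + 1) = mono_count (Suc d) a + min_shadow (Suc d) 1"
    by (rule min_shadow_block) (use mono_count_Suc_pos[of "Suc d" a] in \<open>simp_all del: mono_count_Suc_pos\<close>)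
  ultimately show False using assms min_shadow_pos[of 1 d] by simp
qed

text \<open>
  Macaulay's growth condition for Hilbert functions, restricted to sequences that end with a positive
  entry in degree \<open>e\<close>. It bounds each entry from below by the next one instead of bounding the next one
  from above.
\<close>

definition O_sequence :: "nat list \<Rightarrow> nat \<Rightarrow> bool" where
  "O_sequence h e \<longleftrightarrow> length h = Suc e \<and> 1 \<le> e \<and> h ! 0 = 1 \<and> 0 < h ! e \<and>
    (\<forall>i. 1 \<le> i \<and> i < e \<longrightarrow> min_shadow (Suc i) (h ! Suc i) \<le> h ! i)"

lemma O_sequence_pos:
  assumes "O_sequence h e" "i \<le> e"
  shows "0 < h ! i"
  using assms(2)
proof (induction rule: inc_induct)
  case (step i)
  then have "0 < min_shadow (Suc i) (h ! Suc i)" by (intro min_shadow_pos)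
  then show ?case using assms(1) step by (cases "i = 0") (auto simp: O_sequence_def intro: less_le_trans)
qed (use assms(1) in \<open>simp add: O_sequence_def\<close>)

text \<open>
  Take initial segments with \<open>h\<^sub>i\<close> elements in each degree. The growth condition says that the shadow of
  each segment is contained in the segment one degree lower, and as the shadow has the smallest
  possible size, the socle is as large as the main inequality permits.
\<close>

theorem algebra_with_h_vector:
  assumes h: "O_sequence h e"
  shows "\<exists>I :: 'k::field_char_0 mpoly set. graded_artinian_alg (h ! 1) I e \<and> h_vec (h ! 1) I e = h \<and>
    (\<forall>i. 1 \<le> i \<and> i < e \<longrightarrow> socle_vec (h ! 1) I e ! i = h ! i - min_shadow (Suc i) (h ! Suc i))"
proof -
  define r where "r = h ! 1"
  define N where "N d = (if d \<le> e then init_seg d (h ! d) else {})" for d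
  have len: "length h = Suc e" and e: "1 \<le> e" and h0: "h ! 0 = 1"
    and grow: "\<And>i. 1 \<le> i \<Longrightarrow> i < e \<Longrightarrow> min_shadow (Suc i) (h ! Suc i) \<le> h ! i"
    using h by (auto simp: O_sequence_def)
  have pos: "0 < h ! i" if "i \<le> e" for i using O_sequence_pos[OF h that] .
  have "r > 0" using pos[OF e] by (simp add: r_def)
  have bound: "h ! d \<le> mono_count d r" if "d \<le> e" for d
    using that
  proof (induction d)
    case (Suc d)
    show ?case
    proof (cases d)
      case 0
      then show ?thesis by (simp add: r_def)
    next
      case (Suc c)
      then show ?thesis
        using Suc.IH Suc.prems grow[of d] by (auto intro!: le_mono_count_if_min_shadow_le intro: le_trans)
    qed
  qed (simp add: h0)
  have sh: "shadow (N (Suc d)) \<subseteq> N d" for d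
  proof (cases "Suc d \<le> e")
    case True
    have "min_shadow (Suc d) (h ! Suc d) \<le> h ! d"
    proof (cases "d = 0")
      case True
      have "min_shadow (Suc 0) (mono_count (Suc 0) (Suc (r - 1))) = 1" by (simp only: min_shadow_full mono_count_0)
      then show ?thesis using True \<open>r > 0\<close> h0 by (simp add: r_def)
    next
      case False
      then show ?thesis using grow[of d] \<open>Suc d \<le> e\<close> by simp
    qed
    then show ?thesis using True by (simp add: N_def shadow_init_seg init_seg_mono)
  qed (simp add: N_def)
  have N1: "N 1 = monomials 1 r"
    using e init_seg_full[of 1 "r - 1"] \<open>r > 0\<close> by (simp add: N_def r_def)
  have sub: "N d \<subseteq> monomials d r" for d
    using bound[of d] by (simp add: N_def init_seg_subset_monomials)
  have card: "card (N d) = h ! d" if "d \<le> e" for d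
    using bound[OF that] that by (simp add: N_def card_init_seg)
  have "N e \<noteq> {}" using card[of e] pos[of e] by auto
  moreover have above: "N d = {}" if "d > e" for d using that by (simp add: N_def)
  ultimately obtain I :: "'k mpoly set" where I: "graded_artinian_alg r I e"
      "\<And>d. dim_k r I (graded_piece r I d) = card (N d)"
      "\<And>d. dim_k r I (socle r I \<inter> graded_piece r I d) = card (N d - shadow (N (Suc d)))"
    using monomial_algebra[of N r e, OF sub sh N1 e] by blast
  have "h_vec r I e = h"
    using len card by (intro nth_equalityI) (auto simp: h_vec_nth I(2))
  moreover have "socle_vec r I e ! i = h ! i - min_shadow (Suc i) (h ! Suc i)" if "1 \<le> i" "i < e" for i
  proof -
    have "card (shadow (N (Suc i))) = min_shadow (Suc i) (h ! Suc i)"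
      using that grow[of i] bound[of i] by (simp add: N_def shadow_init_seg card_init_seg[of _ i r])
    moreover have "finite (shadow (N (Suc i)))"
      using finite_subset[OF sub finite_monomials] by (rule finite_shadow)
    ultimately show ?thesis
      using that sh card by (simp add: socle_vec_nth I(3) card_Diff_subset)
  qed
  ultimately show ?thesis using I(1) unfolding r_def by (intro exI[of _ I] conjI allI impI) simp_all
qed

lemma graded_artinian_alg_O_sequence:
  assumes "graded_artinian_alg r I e"
  shows "O_sequence (h_vec r I e) e"
proof -
  note N = graded_artinian_alg_necessary[OF assms]
  have "min_shadow (Suc i) (h_vec r I e ! Suc i) \<le> h_vec r I e ! i" if "i < e" for i
    using N(7)[OF that] by linarith
  then show ?thesis using N(1,2,4) by (simp add: O_sequence_def)
qed

lemma binomial_shift_Suc: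
  "O_sequence h e \<Longrightarrow> i < e \<Longrightarrow> binomial_shift (h ! (i + 1)) (i + 1) (-1) = min_shadow (Suc i) (h ! Suc i)"
  using binomial_shift_eq_min_shadow[of "h ! Suc i" "Suc i"] O_sequence_pos[of h e "Suc i"] by simp

text \<open>
  The pairs of vectors for which the main inequality is an equality in all degrees from \<open>1\<close> to \<open>e - 1\<close>.
\<close>

definition extremal_pair :: "nat list \<Rightarrow> nat list \<Rightarrow> nat \<Rightarrow> bool" where
  "extremal_pair h s e \<longleftrightarrow> O_sequence h e \<and> length s = Suc e \<and> s ! 0 = 0 \<and> s ! e = h ! e \<and>
    (\<forall>i. 1 \<le> i \<and> i < e \<longrightarrow> h ! i = min_shadow (Suc i) (h ! Suc i) + s ! i)"

lemma extremal_pair_realized: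
  assumes "extremal_pair h s e"
  shows "\<exists>I :: 'k::field_char_0 mpoly set.
    graded_artinian_alg (h ! 1) I e \<and> h_vec (h ! 1) I e = h \<and> socle_vec (h ! 1) I e = s"
proof -
  have P: "O_sequence h e" "length s = Suc e" "s ! 0 = 0" "s ! e = h ! e"
    "\<And>i. 1 \<le> i \<Longrightarrow> i < e \<Longrightarrow> h ! i = min_shadow (Suc i) (h ! Suc i) + s ! i"
    using assms by (auto simp: extremal_pair_def)
  obtain I :: "'k mpoly set" where I: "graded_artinian_alg (h ! 1) I e" "h_vec (h ! 1) I e = h"
      "\<And>i. 1 \<le> i \<Longrightarrow> i < e \<Longrightarrow> socle_vec (h ! 1) I e ! i = h ! i - min_shadow (Suc i) (h ! Suc i)"
    using algebra_with_h_vector[OF P(1)] by blast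
  note N = graded_artinian_alg_necessary[OF I(1), unfolded I(2)]
  have "socle_vec (h ! 1) I e = s"
  proof (rule nth_equalityI)
    fix i assume "i < length (socle_vec (h ! 1) I e)"
    then consider "i = 0" | "1 \<le> i" "i < e" | "i = e" by fastforce
    then show "socle_vec (h ! 1) I e ! i = s ! i"
    proof cases
      case 2
      then show ?thesis using I(3)[OF 2] P(5)[OF 2] by simp
    qed (use N(5,6) P(3,4) in simp_all)
  qed (simp add: P(2))
  then show ?thesis using I(1,2) by blast
qed

text \<open>
  Descending induction from the common value in degree \<open>e\<close>: the recursion for \<open>h\<close> and the inequality for
  the algebra differ only in the argument of the monotone function \<open>min_shadow\<close>.
\<close>

lemma extremal_pair_min:
  assumes "extremal_pair h s e" and A: "graded_artinian_alg r I e" and s: "socle_vec r I e = s"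
    and "i \<le> e"
  shows "h ! i \<le> h_vec r I e ! i"
proof (cases "i = 0")
  case True
  then show ?thesis
    using assms(1) graded_artinian_alg_necessary(2)[OF A] by (simp add: extremal_pair_def O_sequence_def)
next
  case False
  note N = graded_artinian_alg_necessary[OF A, unfolded s]
  from \<open>i \<le> e\<close> False show ?thesis
  proof (induction rule: inc_induct)
    case base
    then show ?case using assms(1) N(6) by (simp add: extremal_pair_def)
  next
    case (step j)
    have "h ! j = min_shadow (Suc j) (h ! Suc j) + s ! j"
      using assms(1) step by (simp add: extremal_pair_def)
    also have "\<dots> \<le> min_shadow (Suc j) (h_vec r I e ! Suc j) + s ! j"
      using step by (intro add_right_mono min_shadow_mono) simp
    also have "\<dots> \<le> h_vec r I e ! j" using N(7) step by simp
    finally show ?case .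
  qed
qed

lemma extremal_pair_max:
  assumes "extremal_pair h s e" and A: "graded_artinian_alg r I e" and h: "h_vec r I e = h"
    and "i \<le> e"
  shows "socle_vec r I e ! i \<le> s ! i"
proof -
  note N = graded_artinian_alg_necessary[OF A, unfolded h]
  consider "i = 0" | "1 \<le> i" "i < e" | "i = e" using \<open>i \<le> e\<close> by fastforce
  then show ?thesis
  proof cases
    case 2
    then show ?thesis using N(7)[of i] assms(1) by (simp add: extremal_pair_def)
  qed (use N(5,6) assms(1) in \<open>simp_all add: extremal_pair_def\<close>)
qed

lemma extremal_pair_is_min_h_vector:
  fixes k :: "'k::field_char_0 itself"
  assumes P: "extremal_pair h s e"
  shows "is_min_h_vector k s h"
  unfolding is_min_h_vector_def
proof (intro conjI ballI)
  show "h \<in> h_vectors_for k s"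
  proof -
    obtain I :: "'k mpoly set" where "graded_artinian_alg (h ! 1) I e"
        "h_vec (h ! 1) I e = h" "socle_vec (h ! 1) I e = s"
      using extremal_pair_realized[OF P] by blast
    then show ?thesis unfolding h_vectors_for_def by (intro CollectI exI[of _ "h ! 1"] exI[of _ I] exI[of _ e]) simp
  qed
next
  fix h' assume "h' \<in> h_vectors_for k s"
  then obtain r e' and I :: "'k mpoly set" where A: "graded_artinian_alg r I e'" "socle_vec r I e' = s"
    and h': "h' = h_vec r I e'" by (auto simp: h_vectors_for_def)
  have "e' = e" using P A(2) by (auto simp: extremal_pair_def)
  then show "list_all2 (\<le>) h h'"
    using extremal_pair_min[OF P, of r I] A P
    by (auto simp: h' extremal_pair_def O_sequence_def intro!: list_all2_all_nthI)
qed

lemma extremal_pair_is_max_socle_vector: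
  fixes k :: "'k::field_char_0 itself"
  assumes P: "extremal_pair h s e"
  shows "is_max_socle_vector k h s"
  unfolding is_max_socle_vector_def
proof (intro conjI ballI)
  show "s \<in> socle_vectors_for k h"
  proof -
    obtain I :: "'k mpoly set" where "graded_artinian_alg (h ! 1) I e"
        "h_vec (h ! 1) I e = h" "socle_vec (h ! 1) I e = s"
      using extremal_pair_realized[OF P] by blast
    then show ?thesis unfolding socle_vectors_for_def by (intro CollectI exI[of _ "h ! 1"] exI[of _ I] exI[of _ e]) simp
  qed
next
  fix s' assume "s' \<in> socle_vectors_for k h"
  then obtain r e' and I :: "'k mpoly set" where A: "graded_artinian_alg r I e'" "h_vec r I e' = h"
    and s': "s' = socle_vec r I e'" by (auto simp: socle_vectors_for_def)
  have "e' = e" using P A(2) by (auto simp: extremal_pair_def O_sequence_def)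
  then show "list_all2 (\<le>) s' s"
    using extremal_pair_max[OF P, of r I] A P
    by (auto simp: s' extremal_pair_def intro!: list_all2_all_nthI)
qed

text \<open>
  The growth condition imposes nothing on \<open>s\<close>: the vector \<open>h\<close> defined by the descending recursion
  satisfies it automatically.
\<close>

lemma extremal_pair_exists_for_socle_vector:
  fixes k :: "'k::field_char_0 itself"
  assumes "is_socle_vector k s"
  shows "\<exists>h e. extremal_pair h s e"
proof -
  obtain r e and I :: "'k mpoly set" where A: "graded_artinian_alg r I e" "socle_vec r I e = s"
    using assms by (auto simp: is_socle_vector_def)
  note N = graded_artinian_alg_necessary[OF A(1), unfolded A(2)]
  define H where "H i = foldr (\<lambda>i n. min_shadow (Suc i) n + s ! i) [i..<e] (s ! e)" for i
  have H: "H i = min_shadow (Suc i) (H (Suc i)) + s ! i" if "i < e" for i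
    using that by (simp add: H_def upt_conv_Cons)
  have He: "H e = s ! e" by (simp add: H_def)
  define h where "h = 1 # map H [1..<Suc e]"
  have h: "h ! i = H i" if "1 \<le> i" "i \<le> e" for i
    using that by (cases i) (simp_all add: h_def nth_map del: upt_Suc)
  have he: "h ! e = s ! e" using h[OF N(1)] He by simp
  have rec: "h ! i = min_shadow (Suc i) (h ! Suc i) + s ! i" if "1 \<le> i" "i < e" for i
    using h[of i] h[of "Suc i"] H[of i] that by simp
  have "O_sequence h e"
    unfolding O_sequence_def
  proof (intro conjI allI impI)
    show "min_shadow (Suc i) (h ! Suc i) \<le> h ! i" if "1 \<le> i \<and> i < e" for i
      using rec[of i] that by linarith
  qed (use N(1,4,6) he in \<open>simp_all add: h_def del: upt_Suc\<close>)
  moreover have "length s = Suc e" using A(2) by auto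
  ultimately have "extremal_pair h s e"
    using N(5) he rec by (simp only: extremal_pair_def) simp
  then show ?thesis by blast
qed

text \<open>
  The differences that define \<open>s\<close> are not truncated, because an \<open>h\<close>-vector satisfies the growth
  condition.
\<close>

lemma extremal_pair_exists_for_h_vector:
  fixes k :: "'k::field_char_0 itself"
  assumes "is_h_vector k h"
  shows "\<exists>s e. extremal_pair h s e"
proof -
  obtain r e and I :: "'k mpoly set" where A: "graded_artinian_alg r I e" "h_vec r I e = h"
    using assms by (auto simp: is_h_vector_def)
  have O: "O_sequence h e" using graded_artinian_alg_O_sequence[OF A(1)] A(2) by simp
  define s where "s = map (\<lambda>i. if i = 0 then 0 else if i = e then h ! e
    else h ! i - min_shadow (Suc i) (h ! Suc i)) [0..<Suc e]"
  have "extremal_pair h s e"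
    using O by (auto simp: extremal_pair_def s_def O_sequence_def nth_map simp del: upt_Suc)
  then show ?thesis by blast
qed

lemma list_all2_le_antisym: "list_all2 (\<le>) xs ys \<Longrightarrow> list_all2 (\<le>) ys xs \<Longrightarrow> xs = ys"
  for xs ys :: "nat list"
  by (auto simp: list_all2_conv_all_nth intro!: nth_equalityI antisym)

theorem theorem2p1:
  fixes k :: "'k::field_char_0 itself"
  shows
    "(\<forall>s e. is_socle_vector k s \<and> length s = e + 1 \<longrightarrow>
        (\<exists>h. is_min_h_vector k s h \<and> length h = e + 1 \<and>
          h ! 0 = 1 \<and> h ! e = s ! e \<and>
          (\<forall>i. 1 \<le> i \<and> i < e \<longrightarrow> h ! i = binomial_shift (h ! (i + 1)) (i + 1) (-1) + s ! i) \<and>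
          min_codim k s = h ! 1 \<and>
          h ! 1 = foldr (\<lambda>i n. binomial_shift n (i + 1) (-1) + s ! i) [1..<e] (s ! e)))
     \<and>
     (\<forall>h e. is_h_vector k h \<and> length h = e + 1 \<longrightarrow>
        (\<exists>s. is_max_socle_vector k h s \<and> length s = e + 1 \<and>
          s ! 0 = 0 \<and> s ! e = h ! e \<and>
          (\<forall>i. 1 \<le> i \<and> i < e \<longrightarrow>
            int (s ! i) = int (h ! i) - int (binomial_shift (h ! (i + 1)) (i + 1) (-1)))))
     \<and>
     (\<forall>h s. is_h_vector k h \<and> is_socle_vector k s \<longrightarrow>
        (is_min_h_vector k s h \<longleftrightarrow> is_max_socle_vector k h s))"
proof (intro conjI allI impI)
  fix s e assume s: "is_socle_vector k s \<and> length s = e + 1"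
  then obtain h e' where "extremal_pair h s e'" using extremal_pair_exists_for_socle_vector by blast
  moreover have "e' = e" using s \<open>extremal_pair h s e'\<close> by (simp add: extremal_pair_def)
  ultimately have P: "extremal_pair h s e" by simp
  then have O: "O_sequence h e" and he: "s ! e = h ! e" by (simp_all add: extremal_pair_def)
  have rec: "h ! i = binomial_shift (h ! (i + 1)) (i + 1) (-1) + s ! i" if "1 \<le> i" "i < e" for i
    using P that binomial_shift_Suc[OF O that(2)] by (simp add: extremal_pair_def)
  have fold: "h ! i = foldr (\<lambda>i n. binomial_shift n (i + 1) (-1) + s ! i) [i..<e] (s ! e)"
    if "i \<le> e" "1 \<le> i" for i
    using that
  proof (induction rule: inc_induct)
    case (step j)
    then show ?case using rec[of j] by (simp add: upt_conv_Cons)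
  qed (simp add: he)
  have e: "1 \<le> e" using O by (simp add: O_sequence_def)
  have codim: "min_codim k s = h ! 1"
    unfolding min_codim_def
  proof (rule Least_equality)
    show "\<exists>(I :: 'k mpoly set) e. graded_artinian_alg (h ! 1) I e \<and> socle_vec (h ! 1) I e = s"
      using extremal_pair_realized[OF P] by blast
  next
    fix r assume "\<exists>(I :: 'k mpoly set) e. graded_artinian_alg r I e \<and> socle_vec r I e = s"
    then obtain e' and I :: "'k mpoly set" where A: "graded_artinian_alg r I e'" "socle_vec r I e' = s"
      by blast
    have "e' = e" using A(2) s by auto
    then show "h ! 1 \<le> r"
      using extremal_pair_min[OF P, of r I 1] graded_artinian_alg_necessary(3)[OF A(1)] A e by simp
  qed
  show "\<exists>h. is_min_h_vector k s h \<and> length h = e + 1 \<and> h ! 0 = 1 \<and> h ! e = s ! e \<and>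
      (\<forall>i. 1 \<le> i \<and> i < e \<longrightarrow> h ! i = binomial_shift (h ! (i + 1)) (i + 1) (-1) + s ! i) \<and>
      min_codim k s = h ! 1 \<and>
      h ! 1 = foldr (\<lambda>i n. binomial_shift n (i + 1) (-1) + s ! i) [1..<e] (s ! e)"
  proof (intro exI[of _ h] conjI allI impI)
    show "is_min_h_vector k s h" by (rule extremal_pair_is_min_h_vector[OF P])
    show "h ! i = binomial_shift (h ! (i + 1)) (i + 1) (-1) + s ! i" if "1 \<le> i \<and> i < e" for i
      using that rec by blast
    show "h ! 1 = foldr (\<lambda>i n. binomial_shift n (i + 1) (-1) + s ! i) [1..<e] (s ! e)"
      using fold[OF e] by simp
    show "length h = e + 1" "h ! 0 = 1" using O by (simp_all add: O_sequence_def)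
  qed (use he codim in simp_all)
next
  fix h e assume h: "is_h_vector k h \<and> length h = e + 1"
  then obtain s e' where "extremal_pair h s e'" using extremal_pair_exists_for_h_vector by blast
  moreover have "e' = e" using h \<open>extremal_pair h s e'\<close> by (simp add: extremal_pair_def O_sequence_def)
  ultimately have P: "extremal_pair h s e" by simp
  then have O: "O_sequence h e" by (simp add: extremal_pair_def)
  show "\<exists>s. is_max_socle_vector k h s \<and> length s = e + 1 \<and> s ! 0 = 0 \<and> s ! e = h ! e \<and>
      (\<forall>i. 1 \<le> i \<and> i < e \<longrightarrow>
        int (s ! i) = int (h ! i) - int (binomial_shift (h ! (i + 1)) (i + 1) (-1)))"
  proof (intro exI[of _ s] conjI allI impI)
    show "is_max_socle_vector k h s" by (rule extremal_pair_is_max_socle_vector[OF P])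
    fix i assume i: "1 \<le> i \<and> i < e"
    then have "h ! i = binomial_shift (h ! (i + 1)) (i + 1) (-1) + s ! i"
      using P binomial_shift_Suc[OF O, of i] by (simp add: extremal_pair_def)
    then show "int (s ! i) = int (h ! i) - int (binomial_shift (h ! (i + 1)) (i + 1) (-1))" by linarith
  qed (use P in \<open>simp_all add: extremal_pair_def\<close>)
next
  fix h s assume hs: "is_h_vector k h \<and> is_socle_vector k s"
  show "is_min_h_vector k s h \<longleftrightarrow> is_max_socle_vector k h s"
  proof
    assume min: "is_min_h_vector k s h"
    obtain h' e where P: "extremal_pair h' s e"
      using hs extremal_pair_exists_for_socle_vector by blast
    have "h = h'"
      using min extremal_pair_is_min_h_vector[OF P, of k] list_all2_le_antisym
      unfolding is_min_h_vector_def by blast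
    then show "is_max_socle_vector k h s" using extremal_pair_is_max_socle_vector[OF P] by simp
  next
    assume max: "is_max_socle_vector k h s"
    obtain s' e where P: "extremal_pair h s' e"
      using hs extremal_pair_exists_for_h_vector by blast
    have "s = s'"
      using max extremal_pair_is_max_socle_vector[OF P, of k] list_all2_le_antisym
      unfolding is_max_socle_vector_def by blast
    then show "is_min_h_vector k s h" using extremal_pair_is_min_h_vector[OF P] by simp
  qed
qed

end
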